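(* Let $N\ge1$, $a>0$, $0<\beta\le2$, let $J_0$, $G$, $A$ be as in the context, assume the comparison principle assumption, and let $\alpha>\frac{\beta}{N+1}$. Then there exists $\varepsilon_*>0$ such that for every initial datum $u_0$ satisfying the initial-data assumption and $$m_1(u_0)+\|\mathcal F(\tilde u_0)\|_{L^1(\mathbb R^N)}<\varepsilon_*,$$ the solution of $\partial_t u = Au+|u|^\alpha u$ in $(0,T)\times\mathbb R^N_+$, $u(0)=u_0$, $u(t,x',0)=0$, is global in time, and there is $C=C(u_0)>0$ such that $$\|u(t,\cdot)\|_{L^\infty}\le C(1+t)^{-(N+1)/\beta}\quad\text{for all } t\ge0.$$
   Context: Notation: $x=(x',x_N)\in\mathbb R^{N-1}\times\mathbb R$, $\mathbb R^N_+=\mathbb R^{N-1}\times(0,+\infty)$. Fourier transform: $\mathcal F(f)(\xi)=\hat f(\xi)=\int_{\mathbb R^N}e^{-ix\cdot\xi}f(x)\,dx$. For $f$ on $\mathbb R^N_+$, its odd extension is $\tilde f(x)=f(x)$ if $x_N>0$, $\tilde f(x)=-f(x',-x_N)$ if $x_N<0$. Assumption on $J_0$: $J_0\in C(\mathbb R^N;\mathbb R)$, $J_0(\xi)=1-a|\xi|^\beta+o(|\xi|^\beta)$ as $\xi\to0$, $a>0$, $0<\beta\le2$, and $\sup_{|\xi|\ge r}J_0(\xi)<1$ for all $r>0$. Assumption on $G$: $G\in C((0,\infty);\mathcal M_b(\mathbb R^N))$ (bounded measures), $G(t)\ge0$, $G(t)(\mathbb R^N)=1$, $G(t)$ even in $x_N$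 and in $x'$ (annihilates bounded continuous functions odd in $x_N$, resp. in $x'$), $\mathcal F(G(t))(\xi)=e^{t(J_0(\xi)-1)}$. Assumption on $A$: for every bounded measure $v_0$ the unique solution of $\partial_tv=Av$, $v(0)=v_0$, is $v(t)=G(t)*v_0$. Initial-data assumption: $u_0\in L^\infty(\mathbb R^N_+)\cap L^1(\mathbb R^N_+)$, $u_0\ge0$, $u_0\not\equiv0$, $m_1(u_0):=\int_{\mathbb R^N_+}x_Nu_0\,dx<\infty$. The half-space semilinear problem is solved as the restriction to $\mathbb R^N_+$ of the weak solution on $\mathbb R^N$ of $\partial_t\tilde u=A\tilde u+|\tilde u|^\alpha\tilde u$, $\tilde u(0)=\tilde u_0$, defined on a maximal interval; global means it exists for all $t\ge0$. Comparison principle assumption: the linear and semilinear half-space Cauchy problems satisfy the comparison principle; nonnegative data give nonnegative solutions. *)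

theory Defs
  imports "HOL-Analysis.Analysis" "HOL-Library.Landau_Symbols"
begin

text \<open>Points of R^N are vectors x :: real^'n; a distinguished index k :: 'n plays
  the role of the normal coordinate x_N, so the half space is {x. 0 < x$k}.\<close>

definition halfspace :: "'n \<Rightarrow> (real^'n) set" where
  "halfspace k = {x. 0 < x $ k}"

definition reflN :: "'n \<Rightarrow> real^'n \<Rightarrow> real^'n" where
  "reflN k x = (\<chi> i. if i = k then - (x $ i) else x $ i)"

definition reflT :: "'n \<Rightarrow> real^'n \<Rightarrow> real^'n" where
  "reflT k x = (\<chi> i. if i = k then x $ i else - (x $ i))"

definition oddext :: "'n \<Rightarrow> (real^'n \<Rightarrow> real) \<Rightarrow> real^'n \<Rightarrow> real" where
  "oddext k f x = (if 0 < x $ k then f x else if x $ k < 0 then - f (reflN k x) else 0)"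

definition fourier :: "(real^'n \<Rightarrow> real) \<Rightarrow> real^'n \<Rightarrow> complex" where
  "fourier f \<xi> = (\<integral> x. cis (- (x \<bullet> \<xi>)) * complex_of_real (f x) \<partial>lborel)"

definition fourier_measure :: "(real^'n) measure \<Rightarrow> real^'n \<Rightarrow> complex" where
  "fourier_measure \<mu> \<xi> = (\<integral> x. cis (- (x \<bullet> \<xi>)) \<partial>\<mu>)"

definition conv :: "(real^'n) measure \<Rightarrow> (real^'n \<Rightarrow> real) \<Rightarrow> real^'n \<Rightarrow> real" where
  "conv \<mu> f x = (\<integral> y. f (x - y) \<partial>\<mu>)"

definition nl :: "real \<Rightarrow> real \<Rightarrow> real" where
  "nl \<alpha> v = \<bar>v\<bar> powr \<alpha> * v"

definition m1 :: "'n \<Rightarrow> (real^'n \<Rightarrow> real) \<Rightarrow> real" where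
  "m1 k u0 = (LINT x : halfspace k | lborel. x $ k * u0 x)"

definition init_data :: "'n \<Rightarrow> (real^'n \<Rightarrow> real) \<Rightarrow> bool" where
  "init_data k u0 \<longleftrightarrow>
     u0 \<in> borel_measurable lborel \<and>
     set_integrable lborel (halfspace k) u0 \<and>
     (\<exists>M. AE x in lborel. x \<in> halfspace k \<longrightarrow> \<bar>u0 x\<bar> \<le> M) \<and>
     (AE x in lborel. x \<in> halfspace k \<longrightarrow> 0 \<le> u0 x) \<and>
     \<not> (AE x in lborel. x \<in> halfspace k \<longrightarrow> u0 x = 0) \<and>
     set_integrable lborel (halfspace k) (\<lambda>x. x $ k * u0 x)"

definition half_data :: "'n \<Rightarrow> (real^'n \<Rightarrow> real) \<Rightarrow> bool" where
  "half_data k v0 \<longleftrightarrow>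
     v0 \<in> borel_measurable lborel \<and>
     set_integrable lborel (halfspace k) v0 \<and>
     (\<exists>M. AE x in lborel. x \<in> halfspace k \<longrightarrow> \<bar>v0 x\<bar> \<le> M)"

text \<open>Weak (mild / Duhamel) solution on R^N of  u_t = A u + |u|^alpha u, u(0) = w0,
  on the time interval [0,T) (T = \<infinity> means global), where the semigroup of A is
  v0 \<mapsto> G(t) * v0:
   u(t) = G(t) * w0 + int_0^t G(t-s) * (|u(s)|^alpha u(s)) ds   a.e. in x.
  Solutions are jointly measurable and bounded on [0,T'] x R^N for every T' < T.\<close>
definition mild_sol ::
  "(real \<Rightarrow> (real^'n) measure) \<Rightarrow> real \<Rightarrow> (real^'n \<Rightarrow> real) \<Rightarrow> ereal
     \<Rightarrow> (real \<Rightarrow> real^'n \<Rightarrow> real) \<Rightarrow> bool" where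
  "mild_sol G \<alpha> w0 T u \<longleftrightarrow>
     0 < T \<and>
     (\<lambda>p. u (fst p) (snd p)) \<in> borel_measurable (lborel \<Otimes>\<^sub>M lborel) \<and>
     (\<forall>T'. 0 \<le> T' \<and> ereal T' < T \<longrightarrow> (\<exists>M. \<forall>s\<in>{0..T'}. \<forall>x. \<bar>u s x\<bar> \<le> M)) \<and>
     (AE x in lborel. u 0 x = w0 x) \<and>
     (\<forall>t. 0 < t \<and> ereal t < T \<longrightarrow>
        (AE x in lborel.
           integrable (G t) (\<lambda>y. w0 (x - y)) \<and>
           set_integrable lborel {0..t} (\<lambda>s. conv (G (t - s)) (\<lambda>z. nl \<alpha> (u s z)) x) \<and>
           u t x = conv (G t) w0 x
                   + (LINT s : {0..t} | lborel. conv (G (t - s)) (\<lambda>z. nl \<alpha> (u s z)) x)))"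

end

theory Submission
  imports Defs "HOL-Probability.Probability"
begin

text \<open>
  Write \<open>N = CARD('n)\<close>, \<open>q = (N + 1) / \<beta>\<close> and \<open>v(t) = G(t) * w\<close> with \<open>w\<close> the odd extension of the datum. By oddness
  \<open>\<bar>F w(\<xi>)\<bar> \<le> 2 m\<^sub>1 \<bar>\<xi>\<bar>\<close>. Fourier inversion and the behaviour of \<open>J0\<close> at the origin then give
  \<open>\<parallel>v(t)\<parallel> \<le> C (m\<^sub>1 + \<parallel>F w\<parallel>\<^sub>1) (1 + t)\<close> to the power \<open>-q\<close> in the supremum norm. Since \<open>\<alpha> q > 1\<close>, the integral of
  \<open>\<parallel>v(s)\<parallel>\<close> to the power \<open>\<alpha>\<close> over all times is small for small data, so \<open>2 v\<close> is a supersolution of the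
  Duhamel equation: with \<open>G(t - s) * v(s) = v(t)\<close>, the Duhamel term of \<open>2 v\<close> is at most \<open>v(t)\<close>. On odd functions,
  \<open>G(t)\<close> preserves the order of the half space, so the Picard iterates started at \<open>0\<close> increase there and stay below \<open>2 v\<close>;
  their limit is a global solution with the claimed decay. The comparison principle, applied to two
  solutions with the same datum, shows that every other solution agrees with it on the half space.
\<close>

section \<open>Fourier inversion\<close>

text \<open>The exponent is (N + 1) / \<beta> and not N / \<beta> because the moment bound supplies
  one more factor \<open>norm \<xi>\<close> near the origin, where the frequencies that dominate for
  large times lie. The obstacle that shapes the proof is a gap between the linear comparison
  principle and what an iteration asks for. The principle speaks of bounded integrable data and of
  almost every point; the Duhamel integral applies the kernel to functions known only to be bounded,
  and monotone limits are simplest at every point. The principle is therefore tested on continuous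
  data of bounded support, where continuity makes it hold everywhere, and is then turned into an
  inequality between measures: for \<open>x\<close> in the half space, the law of
  \<open>x - y\<close> under \<open>G t\<close> gives the mirror image of a set in the half space no
  more mass than the set itself. Such an inequality can be integrated against any bounded odd
  function that is nonnegative on the half space. In the same spirit the datum is replaced by its
  continuous representative from Fourier inversion, for which the semigroup law holds at every point
  because symbols multiply.\<close>

lemma open_indicator_approx:
  fixes U :: "'a::metric_space set"
  assumes "open U"
  obtains f :: "nat \<Rightarrow> 'a \<Rightarrow> real" where
    "\<And>n. continuous_on UNIV (f n)" "\<And>n x. 0 \<le> f n x" "\<And>n x. f n x \<le> 1"
    "\<And>n x. x \<notin> U \<Longrightarrow> f n x = 0" "\<And>x. (\<lambda>n. f n x) \<longlonglongrightarrow> indicator U x"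
proof (cases "U = UNIV")
  \<comment> \<open>\<open>infdist\<close> to the empty set is 0 by convention, so an empty
    complement needs its own case.\<close>
  case True
  then show ?thesis by (intro that[of "\<lambda>_ _. 1"]) auto
next
  case False
  then have ne: "- U \<noteq> {}" by auto
  have cl: "closed (- U)" using assms by auto
  define f :: "nat \<Rightarrow> 'a \<Rightarrow> real" where "f n x = min 1 (real n * infdist x (- U))" for n x
  have lim: "(\<lambda>n. f n x) \<longlonglongrightarrow> indicator U x" for x
  proof (cases "x \<in> U")
    case True
    then have pos: "infdist x (- U) > 0"
      using in_closed_iff_infdist_zero[OF cl ne, of x] infdist_nonneg[of x "- U"] by auto
    obtain m :: nat where m: "1 / infdist x (- U) < real m" using reals_Archimedean2 by blast
    have "f n x = 1" if "n \<ge> m" for n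
    proof -
      have "1 / infdist x (- U) < real n" using m that by linarith
      then have "1 < real n * infdist x (- U)" using pos by (simp add: field_simps)
      then show ?thesis by (simp add: f_def)
    qed
    then have "eventually (\<lambda>n. f n x = 1) sequentially"
      by (auto simp: eventually_sequentially)
    then show ?thesis using True by (auto intro: tendsto_eventually)
  next
    case False
    then show ?thesis by (simp add: f_def)
  qed
  show ?thesis
  proof (rule that[of f])
    show "continuous_on UNIV (f n)" for n
      unfolding f_def by (intro continuous_intros)
  qed (use lim in \<open>auto simp: f_def infdist_nonneg\<close>)
qed

text \<open>The fundamental lemma of the calculus of variations. Continuous approximants of
  indicators give zero integral over open subsets of a ball, and the Dynkin class argument extends
  this to Borel sets. The balls are there because \<open>d\<close> is only locally integrable: in
  the inversion theorem it contains a function that is merely bounded.\<close>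

lemma AE_eq_0_if_test_functions:
  fixes d :: "'a::euclidean_space \<Rightarrow> 'b::{banach, second_countable_topology}"
  assumes d: "\<And>r. integrable lborel (\<lambda>x. indicator (ball 0 r) x *\<^sub>R d x)"
    and test: "\<And>\<phi> :: 'a \<Rightarrow> real. continuous_on UNIV \<phi> \<Longrightarrow> (\<And>x. \<bar>\<phi> x\<bar> \<le> 1) \<Longrightarrow>
                 (\<exists>r. \<forall>x. x \<notin> ball 0 r \<longrightarrow> \<phi> x = 0) \<Longrightarrow> (\<integral>x. \<phi> x *\<^sub>R d x \<partial>lborel) = 0"
  shows "AE x in lborel. d x = 0"
proof -
  have AEr: "AE x in lborel. indicator (ball 0 r) x *\<^sub>R d x = 0" for r :: real
  proof -
    let ?B = "ball 0 r :: 'a set"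
    note dr = d[of r]
    have int: "integrable lborel (\<lambda>x. indicator A x *\<^sub>R (indicator ?B x *\<^sub>R d x))" if "A \<in> sets borel" for A
      using integrable_mult_indicator[OF _ dr, of A] that by simp
    have opn: "(\<integral>x. indicator U x *\<^sub>R (indicator ?B x *\<^sub>R d x) \<partial>lborel) = 0" if U: "open U" for U
    proof -
      have "open (U \<inter> ?B)" using U by auto
      then obtain f where f: "\<And>n. continuous_on UNIV (f n)" "\<And>n x. 0 \<le> f n x" "\<And>n x. f n x \<le> (1::real)"
        "\<And>n x. x \<notin> U \<inter> ?B \<Longrightarrow> f n x = 0" "\<And>x. (\<lambda>n. f n x) \<longlonglongrightarrow> indicator (U \<inter> ?B) x"
        by (rule open_indicator_approx) blast
      have [measurable]: "f n \<in> borel_measurable borel" for n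
        using f(1) by (rule borel_measurable_continuous_onI)
      \<comment> \<open>The approximants vanish off the ball, so the hypothesis on the untruncated
        \<open>d\<close> applies to the truncated one.\<close>
      have feq: "f n x *\<^sub>R d x = f n x *\<^sub>R (indicator ?B x *\<^sub>R d x)" for n x
        using f(4)[of x n] by (auto simp: indicator_def)
      have z: "(\<integral>x. f n x *\<^sub>R d x \<partial>lborel) = 0" for n
      proof (rule test[OF f(1)])
        show "\<bar>f n x\<bar> \<le> 1" for x using f(2,3)[where n=n and x=x] by auto
        show "\<exists>r. \<forall>x. x \<notin> ball 0 r \<longrightarrow> f n x = 0" using f(4) by blast
      qed
      have "(\<lambda>n. \<integral>x. f n x *\<^sub>R (indicator ?B x *\<^sub>R d x) \<partial>lborel)
              \<longlonglongrightarrow> (\<integral>x. indicator (U \<inter> ?B) x *\<^sub>R (indicator ?B x *\<^sub>R d x) \<partial>lborel)"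
      proof (rule integral_dominated_convergence[where w="\<lambda>x. norm (indicator ?B x *\<^sub>R d x)"])
        have dm[measurable]: "(\<lambda>x. indicator ?B x *\<^sub>R d x) \<in> borel_measurable lborel"
          using dr by (rule borel_measurable_integrable)
        show "(\<lambda>x. indicator (U \<inter> ?B) x *\<^sub>R (indicator ?B x *\<^sub>R d x)) \<in> borel_measurable lborel"
          using U by (intro borel_measurable_scaleR[OF _ dm] borel_measurable_indicator) (simp add: borel_open sets.Int)
        show "(\<lambda>x. f n x *\<^sub>R (indicator ?B x *\<^sub>R d x)) \<in> borel_measurable lborel" for n
          by (intro borel_measurable_scaleR[OF _ dm]) simp
        show "integrable lborel (\<lambda>x. norm (indicator ?B x *\<^sub>R d x))"
          using dr by (rule integrable_norm)
        show "AE x in lborel. (\<lambda>n. f n x *\<^sub>R (indicator ?B x *\<^sub>R d x))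
                \<longlonglongrightarrow> indicator (U \<inter> ?B) x *\<^sub>R (indicator ?B x *\<^sub>R d x)"
          by (intro AE_I2 tendsto_scaleR f tendsto_const)
        show "AE x in lborel. norm (f n x *\<^sub>R (indicator ?B x *\<^sub>R d x)) \<le> norm (indicator ?B x *\<^sub>R d x)" for n
        proof (intro AE_I2)
          fix x
          have "\<bar>f n x\<bar> * norm (indicator ?B x *\<^sub>R d x) \<le> 1 * norm (indicator ?B x *\<^sub>R d x)"
            using f(2,3)[where n=n and x=x] by (intro mult_right_mono) auto
          then show "norm (f n x *\<^sub>R (indicator ?B x *\<^sub>R d x)) \<le> norm (indicator ?B x *\<^sub>R d x)"
            by (simp only: norm_scaleR mult_1)
        qed
      qed
      then have "(\<integral>x. indicator (U \<inter> ?B) x *\<^sub>R (indicator ?B x *\<^sub>R d x) \<partial>lborel) = 0"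
        using z by (simp add: feq LIMSEQ_const_iff)
      moreover have "(\<lambda>x. indicator (U \<inter> ?B) x *\<^sub>R (indicator ?B x *\<^sub>R d x)) = (\<lambda>x. indicator U x *\<^sub>R (indicator ?B x *\<^sub>R d x))"
        by (auto simp: indicator_def)
      ultimately show ?thesis by (simp only:)
    qed
    show ?thesis
    proof (rule sigma_finite_measure.density_zero[OF lborel.sigma_finite_measure_axioms dr])
      fix A :: "'a set" assume "A \<in> sets lborel"
      then have A: "A \<in> sigma_sets UNIV {S. open S}" by (simp add: borel_def)
      have st: "Int_stable {S :: 'a set. open S}" "{S :: 'a set. open S} \<subseteq> Pow UNIV"
        by (auto simp: Int_stable_def)
      from A have "(\<integral>x. indicator A x *\<^sub>R (indicator ?B x *\<^sub>R d x) \<partial>lborel) = 0"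
      proof (induction rule: sigma_sets_induct_disjoint[OF st, consumes 1, case_names basic empty compl union])
        case (basic A)
        then show ?case using opn by auto
      next
        case empty
        then show ?case by simp
      next
        case (compl A)
        then have A: "A \<in> sets borel" by (simp add: borel_def)
        have "(\<integral>x. indicator (UNIV - A) x *\<^sub>R (indicator ?B x *\<^sub>R d x) \<partial>lborel)
            = (\<integral>x. indicator UNIV x *\<^sub>R (indicator ?B x *\<^sub>R d x) - indicator A x *\<^sub>R (indicator ?B x *\<^sub>R d x) \<partial>lborel)"
          by (intro Bochner_Integration.integral_cong) (auto simp: indicator_def)
        also have "\<dots> = 0"
          using opn[of UNIV] compl
          by (subst Bochner_Integration.integral_diff) (use int[OF A] int[of UNIV] in auto)
        finally show ?case .
      next
        case (union A)
        then have A: "A i \<in> sets borel" for i by (auto simp: borel_def)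
        have "set_lebesgue_integral lborel (\<Union>i. A i) (\<lambda>x. indicator ?B x *\<^sub>R d x)
             = (\<Sum>i. set_lebesgue_integral lborel (A i) (\<lambda>x. indicator ?B x *\<^sub>R d x))"
        proof (rule lebesgue_integral_countable_add)
          show "A i \<in> sets lborel" for i using A by simp
          show "A i \<inter> A j = {}" if "i \<noteq> j" for i j
            using union that by (auto simp: disjoint_family_on_def)
          show "set_integrable lborel (\<Union>i. A i) (\<lambda>x. indicator ?B x *\<^sub>R d x)"
            unfolding set_integrable_def using A by (intro int) auto
        qed
        then show ?case using union by (simp add: set_lebesgue_integral_def)
      qed
      then show "set_lebesgue_integral lborel A (\<lambda>x. indicator ?B x *\<^sub>R d x) = 0"
        by (simp add: set_lebesgue_integral_def)
    qed
  qed
  then have "AE x in lborel. \<forall>n::nat. indicator (ball 0 (real n)) x *\<^sub>R d x = 0"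
    unfolding AE_all_countable by blast
  then show ?thesis
  proof eventually_elim
    case (elim x)
    obtain n :: nat where "norm x < real n" using reals_Archimedean2 by blast
    then show ?case using elim[rule_format, of n] by (simp add: indicator_def)
  qed
qed

section \<open>Integration tools: Fubini under a product bound, product integrands,
  Gaussians\<close>

lemma (in pair_sigma_finite) Fubini_product_bound:
  fixes h :: "'a \<Rightarrow> 'b \<Rightarrow> 'c::{banach, second_countable_topology}"
  assumes h[measurable]: "case_prod h \<in> borel_measurable (M1 \<Otimes>\<^sub>M M2)"
    and f: "integrable M1 f" and g: "integrable M2 g"
    and le: "\<And>x y. norm (h x y) \<le> f x * (g y :: real)"
  shows "integrable (M1 \<Otimes>\<^sub>M M2) (case_prod h)"
    and "(\<integral>y. (\<integral>x. h x y \<partial>M1) \<partial>M2) = (\<integral>x. (\<integral>y. h x y \<partial>M2) \<partial>M1)"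
proof -
  have [measurable]: "f \<in> borel_measurable M1" "g \<in> borel_measurable M2"
    using f g by auto
  have "integrable (M1 \<Otimes>\<^sub>M M2) (\<lambda>(x, y). f x * g y)"
    using g by (intro Fubini_integrable) (auto simp: abs_mult intro!: integrable_mult_left f)
  then show *: "integrable (M1 \<Otimes>\<^sub>M M2) (case_prod h)"
    by (rule Bochner_Integration.integrable_bound) (auto intro!: AE_I2 order_trans[OF le abs_ge_self])
  show "(\<integral>y. (\<integral>x. h x y \<partial>M1) \<partial>M2) = (\<integral>x. (\<integral>y. h x y \<partial>M2) \<partial>M1)"
    using * by (rule Fubini_integral)
qed

text \<open>Lebesgue measure on a Euclidean space is the image of the product of one-dimensional
  Lebesgue measures indexed by \<open>Basis\<close>, so the finite product theorems
  transfer.\<close>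

lemma
  fixes f :: "'a::euclidean_space \<Rightarrow> real \<Rightarrow> 'b::{real_normed_field, banach, second_countable_topology}"
  assumes f: "\<And>b. b \<in> Basis \<Longrightarrow> integrable lborel (f b)"
  shows integrable_lborel_prod: "integrable lborel (\<lambda>x. \<Prod>b\<in>Basis. f b (x \<bullet> b))"
    and integral_lborel_prod: "(\<integral>x. (\<Prod>b\<in>Basis. f b (x \<bullet> b)) \<partial>lborel) = (\<Prod>b\<in>Basis. \<integral>x. f b x \<partial>lborel)"
proof -
  interpret product_sigma_finite "\<lambda>_::'a. lborel :: real measure" by standard
  have [measurable]: "f b \<in> borel_measurable borel" if "b \<in> Basis" for b
    using f[OF that] by auto
  have eq: "(\<Prod>b\<in>Basis. f b ((\<Sum>c\<in>Basis. p c *\<^sub>R c) \<bullet> b)) = (\<Prod>b\<in>Basis. f b (p b))" for p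
    by (intro prod.cong refl) (simp add: inner_sum_left inner_Basis if_distrib cong: if_cong)
  show "integrable lborel (\<lambda>x. \<Prod>b\<in>Basis. f b (x \<bullet> b))"
    by (subst lborel_eq, subst integrable_distr_eq)
       (use f in \<open>auto simp: eq intro!: product_integrable_prod\<close>)
  show "(\<integral>x. (\<Prod>b\<in>Basis. f b (x \<bullet> b)) \<partial>lborel) = (\<Prod>b\<in>Basis. \<integral>x. f b x \<partial>lborel)"
    by (subst lborel_eq, subst integral_distr)
       (use f in \<open>auto simp: eq intro!: product_integral_prod\<close>)
qed

text \<open>The second claim is the characteristic function of the standard normal law, with the
  density left unnormalised.\<close>

lemma
  fixes t :: real
  shows integrable_gauss_real: "integrable lborel (\<lambda>x. exp (- (x\<^sup>2) / 2) :: real)"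
    and integral_cis_gauss_real:
      "(\<integral>x. cis (t * x) * complex_of_real (exp (- (x\<^sup>2) / 2)) \<partial>lborel)
         = complex_of_real (sqrt (2 * pi) * exp (- (t\<^sup>2) / 2))"
proof -
  have eq: "exp (- (x\<^sup>2) / 2) = sqrt (2 * pi) * std_normal_density x" for x :: real
    by (simp add: std_normal_density_def)
  show "integrable lborel (\<lambda>x. exp (- (x\<^sup>2) / 2) :: real)"
    unfolding eq by (intro integrable_mult_right) (simp add: integrable_normal_density)
  have "complex_of_real (exp (- (t\<^sup>2) / 2)) = char std_normal_distribution t"
    by (simp add: char_std_normal_distribution)
  also have "\<dots> = (\<integral>x. std_normal_density x *\<^sub>R cis (t * x) \<partial>lborel)"
    unfolding char_def by (subst integral_density) (auto simp: cis_conv_exp)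
  finally have "complex_of_real (sqrt (2 * pi) * exp (- (t\<^sup>2) / 2))
      = complex_of_real (sqrt (2 * pi)) * (\<integral>x. std_normal_density x *\<^sub>R cis (t * x) \<partial>lborel)"
    by simp
  also have "\<dots> = (\<integral>x. complex_of_real (sqrt (2 * pi)) * (std_normal_density x *\<^sub>R cis (t * x)) \<partial>lborel)"
    by (rule integral_mult_right_zero[symmetric])
  also have "\<dots> = (\<integral>x. cis (t * x) * complex_of_real (exp (- (x\<^sup>2) / 2)) \<partial>lborel)"
    unfolding eq by (intro Bochner_Integration.integral_cong) (auto simp: scaleR_conv_of_real)
  finally show "(\<integral>x. cis (t * x) * complex_of_real (exp (- (x\<^sup>2) / 2)) \<partial>lborel)
         = complex_of_real (sqrt (2 * pi) * exp (- (t\<^sup>2) / 2))" ..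
qed

text \<open>Normalised by its value 1 at the origin rather than by its mass, so that
  \<open>gauss (e *\<^sub>R \<xi>)\<close> tends to 1 as a summability factor; its own Fourier
  transform is a constant multiple of it.\<close>

definition gauss :: "'a::euclidean_space \<Rightarrow> real" where
  "gauss x = exp (- (x \<bullet> x) / 2)"

lemma gauss_prod: "gauss (x :: 'a::euclidean_space) = (\<Prod>b\<in>Basis. exp (- ((x \<bullet> b)\<^sup>2) / 2))"
  by (simp add: gauss_def euclidean_inner[of x x] exp_sum[symmetric] sum_negf sum_divide_distrib power2_eq_square)

lemma gauss_pos: "0 < gauss x" and gauss_le_1: "gauss x \<le> 1"
  by (simp_all add: gauss_def)

lemma continuous_on_gauss [continuous_intros]: "continuous_on S f \<Longrightarrow> continuous_on S (\<lambda>x. gauss (f x))"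
  unfolding gauss_def by (intro continuous_intros) auto

lemma borel_measurable_gauss [measurable]: "gauss \<in> borel_measurable borel"
  by (intro borel_measurable_continuous_onI continuous_on_gauss continuous_on_id)

lemma cis_inner_prod: "cis (z \<bullet> (x :: 'a::euclidean_space)) = (\<Prod>b\<in>Basis. cis ((z \<bullet> b) * (x \<bullet> b)))"
  by (simp add: euclidean_inner[of z x] cis_conv_exp exp_sum[symmetric] sum_distrib_left)

lemma integrable_gauss: "integrable lborel (gauss :: 'a::euclidean_space \<Rightarrow> real)"
  unfolding gauss_prod[abs_def] by (intro integrable_lborel_prod integrable_gauss_real)

lemma integral_cis_gauss:
  fixes z :: "'a::euclidean_space"
  shows "(\<integral>x. cis (z \<bullet> x) * complex_of_real (gauss x) \<partial>lborel)
           = complex_of_real (sqrt (2 * pi) ^ DIM('a) * gauss z)"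
proof -
  let ?f = "\<lambda>(b::'a) x. cis ((z \<bullet> b) * x) * complex_of_real (exp (- (x\<^sup>2) / 2))"
  have int: "integrable lborel (?f b)" for b
    by (rule Bochner_Integration.integrable_bound[OF integrable_gauss_real])
       (auto simp: norm_mult cis_conv_exp)
  have "(\<integral>x. cis (z \<bullet> x) * complex_of_real (gauss x) \<partial>lborel)
      = (\<integral>x. (\<Prod>b\<in>Basis. ?f b (x \<bullet> b)) \<partial>lborel)"
    by (simp add: gauss_prod cis_inner_prod prod.distrib)
  also have "\<dots> = (\<Prod>b\<in>Basis. integral\<^sup>L lborel (?f b))"
    by (rule integral_lborel_prod[OF int])
  also have "\<dots> = complex_of_real (sqrt (2 * pi) ^ DIM('a) * gauss z)"
    unfolding integral_cis_gauss_real by (simp add: gauss_prod prod.distrib)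
  finally show ?thesis .
qed

lemma lborel_integral_affine:
  fixes f :: "'a::euclidean_space \<Rightarrow> 'b::{banach, second_countable_topology}"
  assumes [measurable]: "f \<in> borel_measurable borel" and c: "c \<noteq> 0"
  shows "(\<integral>x. f x \<partial>lborel) = \<bar>c\<bar> ^ DIM('a) *\<^sub>R (\<integral>x. f (t + c *\<^sub>R x) \<partial>lborel)"
  by (subst lborel_affine[OF c, of t]) (simp add: integral_density integral_distr)

lemma lborel_nn_integral_affine:
  fixes f :: "'a::euclidean_space \<Rightarrow> ennreal"
  assumes [measurable]: "f \<in> borel_measurable borel" and c: "c \<noteq> 0"
  shows "(\<integral>\<^sup>+x. f x \<partial>lborel) = ennreal (\<bar>c\<bar> ^ DIM('a)) * (\<integral>\<^sup>+x. f (t + c *\<^sub>R x) \<partial>lborel)"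
  by (subst lborel_affine[OF c, of t]) (simp add: nn_integral_density nn_integral_distr nn_integral_cmult)

lemma integrable_indicator_ball:
  "integrable lborel (indicator (ball c r :: 'a::euclidean_space set) :: 'a \<Rightarrow> real)"
  using emeasure_bounded_finite[OF bounded_ball, of c r] by (intro integrable_real_indicator) auto

lemma continuous_on_cis_compose [continuous_intros]:
  "continuous_on S f \<Longrightarrow> continuous_on S (\<lambda>x. cis (f x))"
  unfolding cis_conv_exp by (intro continuous_intros)

lemma borel_measurable_cis [measurable]: "cis \<in> borel_measurable borel"
  by (intro borel_measurable_continuous_onI continuous_on_cis_compose continuous_on_id)

lemma borel_measurable_fourier [measurable]:
  fixes f :: "real^'n::finite \<Rightarrow> real"
  assumes [measurable]: "f \<in> borel_measurable borel"
  shows "fourier f \<in> borel_measurable borel"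
proof -
  have "(\<lambda>\<xi>. \<integral> x. cis (- (x \<bullet> \<xi>)) * complex_of_real (f x) \<partial>lborel) \<in> borel_measurable (borel :: (real^'n) measure)"
    by (intro lborel.borel_measurable_lebesgue_integral) measurable
  then show ?thesis unfolding fourier_def[abs_def] .
qed

text \<open>A Parseval identity for the regularised inverse transform. On the left the Gaussian
  damps high frequencies, on the right it averages \<open>\<phi>\<close> at scale \<open>e\<close>;
  both sides have evident limits as \<open>e\<close> tends to 0. It rests on two applications of
  Fubini, both possible because the Gaussian or \<open>\<phi>\<close> makes the integrand absolutely
  integrable.\<close>

lemma fourier_gauss_mean:
  fixes f \<phi> :: "real^'n::finite \<Rightarrow> real"
  assumes f: "integrable lborel f" and \<phi>[measurable]: "\<phi> \<in> borel_measurable borel"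
    and \<phi>1: "integrable lborel \<phi>" "\<And>x. \<bar>\<phi> x\<bar> \<le> 1" and e: "0 < e"
  shows "(\<integral>x. \<phi> x *\<^sub>R (\<integral>\<xi>. cis (x \<bullet> \<xi>) * fourier f \<xi> * complex_of_real (gauss (e *\<^sub>R \<xi>)) \<partial>lborel) \<partial>lborel)
       = complex_of_real (sqrt (2 * pi) ^ CARD('n) * (\<integral>y. f y * (\<integral>z. \<phi> (y + e *\<^sub>R z) * gauss z \<partial>lborel) \<partial>lborel))"
proof -
  let ?c = "sqrt (2 * pi) ^ CARD('n)"
  have [measurable]: "f \<in> borel_measurable borel" using f by auto
  have ge: "integrable lborel (\<lambda>\<xi>::real^'n. gauss (e *\<^sub>R \<xi>))"
  proof -
    have "(\<integral>\<^sup>+x. ennreal (gauss x) \<partial>(lborel :: (real^'n) measure)) < \<infinity>"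
      using integrable_gauss[where 'a="real^'n"] gauss_pos[where 'a="real^'n"] by (auto simp: integrable_iff_bounded less_imp_le)
    then have "ennreal (e ^ CARD('n)) * (\<integral>\<^sup>+x. ennreal (gauss (e *\<^sub>R x)) \<partial>(lborel :: (real^'n) measure)) < \<infinity>"
      by (subst (asm) lborel_nn_integral_affine[of _ e 0]) (use e in auto)
    then show ?thesis
      using e gauss_pos[where 'a="real^'n"] by (auto simp: integrable_iff_bounded less_imp_le ennreal_mult_less_top)
  qed
  \<comment> \<open>The wide Gaussian in frequency becomes one of width \<open>e\<close> in space:
    an approximate identity up to normalisation.\<close>
  have k: "(\<integral>\<xi>. cis ((x - y) \<bullet> \<xi>) * complex_of_real (gauss (e *\<^sub>R \<xi>)) \<partial>lborel)
         = complex_of_real (?c * gauss ((1 / e) *\<^sub>R (x - y)) / e ^ CARD('n))" for x y :: "real^'n"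
  proof -
    let ?f = "\<lambda>\<eta>. cis (((1 / e) *\<^sub>R (x - y)) \<bullet> \<eta>) * complex_of_real (gauss \<eta>)"
    have fe: "?f (0 + e *\<^sub>R \<xi>) = cis ((x - y) \<bullet> \<xi>) * complex_of_real (gauss (e *\<^sub>R \<xi>))" for \<xi>
      using e by simp
    have "complex_of_real (?c * gauss ((1 / e) *\<^sub>R (x - y))) = (\<integral>\<eta>. ?f \<eta> \<partial>lborel)"
      by (subst integral_cis_gauss) simp
    also have "\<dots> = \<bar>e\<bar> ^ DIM(real^'n) *\<^sub>R (\<integral>\<xi>. ?f (0 + e *\<^sub>R \<xi>) \<partial>lborel)"
      by (rule lborel_integral_affine) (use e in simp_all)
    also have "\<dots> = complex_of_real (e ^ CARD('n)) * (\<integral>\<xi>. cis ((x - y) \<bullet> \<xi>) * complex_of_real (gauss (e *\<^sub>R \<xi>)) \<partial>lborel)"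
      unfolding fe using e by (simp add: scaleR_conv_of_real)
    finally show ?thesis using e by (simp add: nonzero_eq_divide_eq mult.commute)
  qed
  have A: "(\<integral>\<xi>. cis (x \<bullet> \<xi>) * fourier f \<xi> * complex_of_real (gauss (e *\<^sub>R \<xi>)) \<partial>lborel)
         = complex_of_real (\<integral>y. f y * (?c * gauss ((1 / e) *\<^sub>R (x - y)) / e ^ CARD('n)) \<partial>lborel)" for x
  proof -
    let ?h = "\<lambda>\<xi> y. cis ((x - y) \<bullet> \<xi>) * complex_of_real (f y) * complex_of_real (gauss (e *\<^sub>R \<xi>))"
    have "(\<integral>\<xi>. cis (x \<bullet> \<xi>) * fourier f \<xi> * complex_of_real (gauss (e *\<^sub>R \<xi>)) \<partial>lborel)
        = (\<integral>\<xi>. (\<integral>y. ?h \<xi> y \<partial>lborel) \<partial>lborel)"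
    proof (intro Bochner_Integration.integral_cong refl)
      fix \<xi> :: "real^'n"
      have "cis (x \<bullet> \<xi>) * fourier f \<xi> * complex_of_real (gauss (e *\<^sub>R \<xi>))
          = (\<integral>y. cis (x \<bullet> \<xi>) * (cis (- (y \<bullet> \<xi>)) * complex_of_real (f y)) * complex_of_real (gauss (e *\<^sub>R \<xi>)) \<partial>lborel)"
        by (simp add: fourier_def)
      also have "\<dots> = (\<integral>y. ?h \<xi> y \<partial>lborel)"
        by (simp only: mult.assoc[symmetric] cis_mult) (simp add: inner_diff_left)
      finally show "cis (x \<bullet> \<xi>) * fourier f \<xi> * complex_of_real (gauss (e *\<^sub>R \<xi>)) = (\<integral>y. ?h \<xi> y \<partial>lborel)" .
    qed
    also have "\<dots> = (\<integral>y. (\<integral>\<xi>. ?h \<xi> y \<partial>lborel) \<partial>lborel)"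
      by (rule lborel_pair.Fubini_product_bound(2)[symmetric, where f="\<lambda>\<xi>. gauss (e *\<^sub>R \<xi>)" and g="\<lambda>y. \<bar>f y\<bar>"])
         (use f ge gauss_pos[where 'a="real^'n"] in \<open>auto simp: norm_mult less_imp_le\<close>)
    also have "\<dots> = (\<integral>y. complex_of_real (f y) * (\<integral>\<xi>. cis ((x - y) \<bullet> \<xi>) * complex_of_real (gauss (e *\<^sub>R \<xi>)) \<partial>lborel) \<partial>lborel)"
      by (subst integral_mult_right_zero[symmetric]) (simp add: mult_ac)
    also have "\<dots> = (\<integral>y. complex_of_real (f y * (?c * gauss ((1 / e) *\<^sub>R (x - y)) / e ^ CARD('n))) \<partial>lborel)"
      unfolding k by simp
    finally show ?thesis by (simp only: integral_complex_of_real)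
  qed
  let ?k = "\<lambda>x y. \<phi> x * (f y * (?c * gauss ((1 / e) *\<^sub>R (x - y)) / e ^ CARD('n)))"
  have "(\<integral>x. \<phi> x * (\<integral>y. f y * (?c * gauss ((1 / e) *\<^sub>R (x - y)) / e ^ CARD('n)) \<partial>lborel) \<partial>lborel)
      = (\<integral>x. (\<integral>y. ?k x y \<partial>lborel) \<partial>lborel)"
    by simp
  also have "\<dots> = (\<integral>y. (\<integral>x. ?k x y \<partial>lborel) \<partial>lborel)"
  proof (rule lborel_pair.Fubini_product_bound(2)[symmetric, where f="\<lambda>x. \<bar>\<phi> x\<bar>" and g="\<lambda>y. \<bar>f y\<bar> * (?c / e ^ CARD('n))"])
    show "norm (?k x y) \<le> \<bar>\<phi> x\<bar> * (\<bar>f y\<bar> * (?c / e ^ CARD('n)))" for x y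
    proof -
      have "?c * gauss ((1 / e) *\<^sub>R (x - y)) / e ^ CARD('n) \<le> ?c / e ^ CARD('n)"
        using gauss_le_1[of "(1 / e) *\<^sub>R (x - y)"] e by (intro divide_right_mono mult_left_le) auto
      moreover have "0 \<le> ?c * gauss ((1 / e) *\<^sub>R (x - y)) / e ^ CARD('n)"
        using gauss_pos[of "(1 / e) *\<^sub>R (x - y)"] e by auto
      ultimately show ?thesis unfolding real_norm_def abs_mult by (intro mult_left_mono) auto
    qed
  qed (use f \<phi>1 in auto)
  \<comment> \<open>Substituting \<open>x = y + e *\<^sub>R z\<close> cancels
    \<open>e ^ CARD('n)\<close> and moves the parameter into the argument of \<open>\<phi>\<close>,
    where continuity can act.\<close>
  also have "\<dots> = (\<integral>y. ?c * (f y * (\<integral>z. \<phi> (y + e *\<^sub>R z) * gauss z \<partial>lborel)) \<partial>lborel)"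
  proof (intro Bochner_Integration.integral_cong refl)
    fix y :: "real^'n"
    have "(\<integral>x. ?k x y \<partial>lborel) = e ^ CARD('n) *\<^sub>R (\<integral>z. ?k (y + e *\<^sub>R z) y \<partial>lborel)"
      by (subst lborel_integral_affine[of _ e y]) (use e in auto)
    also have "\<dots> = e ^ CARD('n) *\<^sub>R (\<integral>z. (f y * ?c / e ^ CARD('n)) * (\<phi> (y + e *\<^sub>R z) * gauss z) \<partial>lborel)"
      using e by (simp add: mult_ac)
    also have "\<dots> = ?c * (f y * (\<integral>z. \<phi> (y + e *\<^sub>R z) * gauss z \<partial>lborel))"
      unfolding integral_mult_right_zero using e by (simp add: mult_ac)
    finally show "(\<integral>x. ?k x y \<partial>lborel) = ?c * (f y * (\<integral>z. \<phi> (y + e *\<^sub>R z) * gauss z \<partial>lborel))" .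
  qed
  finally have B: "(\<integral>x. \<phi> x * (\<integral>y. f y * (?c * gauss ((1 / e) *\<^sub>R (x - y)) / e ^ CARD('n)) \<partial>lborel) \<partial>lborel)
      = ?c * (\<integral>y. f y * (\<integral>z. \<phi> (y + e *\<^sub>R z) * gauss z \<partial>lborel) \<partial>lborel)"
    by (simp only: integral_mult_right_zero)
  show ?thesis
    unfolding A B[symmetric] scaleR_conv_of_real[where 'a=complex] of_real_mult[symmetric] integral_complex_of_real ..
qed

text \<open>Both sides of \<open>fourier_gauss_mean\<close> are passed to the limit against a
  continuous \<open>\<phi>\<close> of bounded support. The limits rest on dominated convergence
  alone, with majorants from the integrability of the transform, of \<open>f\<close> and of the
  Gaussian; the test function lemma then removes \<open>\<phi>\<close>.\<close>

theorem fourier_inversion: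
  fixes f :: "real^'n::finite \<Rightarrow> real"
  assumes f: "integrable lborel f" and F: "integrable lborel (fourier f)"
  shows "AE x in lborel. complex_of_real (f x) = (\<integral>\<xi>. cis (x \<bullet> \<xi>) * fourier f \<xi> \<partial>lborel) / (2 * pi) ^ CARD('n)"
proof -
  let ?c = "sqrt (2 * pi) ^ CARD('n)"
  \<comment> \<open>One factor \<open>?c\<close> comes from transforming the Gaussian, the other is
    its total mass.\<close>
  have cc: "?c * ?c = (2 * pi) ^ CARD('n)"
    unfolding power_mult_distrib[symmetric] by simp
  have [measurable]: "f \<in> borel_measurable borel" using f by auto
  define g where "g x = (\<integral>\<xi>. cis (x \<bullet> \<xi>) * fourier f \<xi> \<partial>lborel)" for x
  define A where "A n x = (\<integral>\<xi>. cis (x \<bullet> \<xi>) * fourier f \<xi> * complex_of_real (gauss ((1 / real (Suc n)) *\<^sub>R \<xi>)) \<partial>lborel)" for n x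
  have gm[measurable]: "g \<in> borel_measurable borel"
    unfolding g_def[abs_def] by (intro lborel.borel_measurable_lebesgue_integral) measurable
  have Am[measurable]: "A n \<in> borel_measurable borel" for n
    unfolding A_def[abs_def] by (intro lborel.borel_measurable_lebesgue_integral) measurable
  define L where "L = (\<integral>\<xi>. norm (fourier f \<xi>) \<partial>lborel)"
  \<comment> \<open>The free weight serves the limit \<open>g\<close> (weight 1) and the
    approximants \<open>A n\<close> (Gaussian weight) at once.\<close>
  have le_L: "norm (\<integral>\<xi>. cis (x \<bullet> \<xi>) * fourier f \<xi> * complex_of_real (w \<xi>) \<partial>lborel) \<le> L"
    if w: "\<And>\<xi>. \<bar>w \<xi>\<bar> \<le> 1" "w \<in> borel_measurable borel" for w x
  proof -
    note [measurable] = w(2)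
    have bd: "norm (cis (x \<bullet> \<xi>) * fourier f \<xi> * complex_of_real (w \<xi>)) \<le> norm (fourier f \<xi>)" for \<xi>
      using w(1)[of \<xi>] by (simp add: norm_mult mult_left_le)
    have "integrable lborel (\<lambda>\<xi>. cis (x \<bullet> \<xi>) * fourier f \<xi> * complex_of_real (w \<xi>))"
      by (rule Bochner_Integration.integrable_bound[OF F]) (use bd in auto)
    then show ?thesis unfolding L_def
      by (intro order_trans[OF integral_norm_bound] integral_mono integrable_norm F bd)
  qed
  have gL: "norm (g x) \<le> L" for x
    using le_L[of "\<lambda>_. 1" x] by (simp add: g_def)
  have AL: "norm (A n x) \<le> L" for n x
    unfolding A_def using gauss_pos[where 'a="real^'n"] gauss_le_1[where 'a="real^'n"]
    by (intro le_L) (auto simp: abs_of_pos)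
  have e0: "(\<lambda>n. 1 / real (Suc n)) \<longlonglongrightarrow> 0"
    using LIMSEQ_inverse_real_of_nat by (simp add: inverse_eq_divide)
  have gl: "isCont gauss (z :: real^'n)" for z
    using continuous_on_gauss[OF continuous_on_id, of "UNIV :: (real^'n) set"] by (simp add: continuous_on_eq_continuous_at)
  have Alim: "(\<lambda>n. A n x) \<longlonglongrightarrow> g x" for x
    unfolding A_def g_def
  proof (rule integral_dominated_convergence[where w="\<lambda>\<xi>. norm (fourier f \<xi>)"])
    show "AE \<xi> in lborel. (\<lambda>n. cis (x \<bullet> \<xi>) * fourier f \<xi> * complex_of_real (gauss ((1 / real (Suc n)) *\<^sub>R \<xi>)))
        \<longlonglongrightarrow> cis (x \<bullet> \<xi>) * fourier f \<xi>"
    proof (intro AE_I2)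
      fix \<xi> :: "real^'n"
      have "(\<lambda>n. gauss ((1 / real (Suc n)) *\<^sub>R \<xi>)) \<longlonglongrightarrow> gauss (0 *\<^sub>R \<xi>)"
        by (intro isCont_tendsto_compose[OF gl] tendsto_scaleR e0 tendsto_const)
      then have "(\<lambda>n. cis (x \<bullet> \<xi>) * fourier f \<xi> * complex_of_real (gauss ((1 / real (Suc n)) *\<^sub>R \<xi>)))
          \<longlonglongrightarrow> cis (x \<bullet> \<xi>) * fourier f \<xi> * complex_of_real (gauss (0 *\<^sub>R \<xi>))"
        by (intro tendsto_mult tendsto_const tendsto_of_real)
      then show "(\<lambda>n. cis (x \<bullet> \<xi>) * fourier f \<xi> * complex_of_real (gauss ((1 / real (Suc n)) *\<^sub>R \<xi>)))
        \<longlonglongrightarrow> cis (x \<bullet> \<xi>) * fourier f \<xi>" by (simp add: gauss_def)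
    qed
    show "AE \<xi> in lborel. norm (cis (x \<bullet> \<xi>) * fourier f \<xi> * complex_of_real (gauss ((1 / real (Suc n)) *\<^sub>R \<xi>))) \<le> norm (fourier f \<xi>)" for n
      using gauss_pos[where 'a="real^'n"] gauss_le_1[where 'a="real^'n"]
      by (auto simp: norm_mult abs_of_pos mult_left_le)
  qed (use F in auto)
  have "AE x in lborel. (?c * ?c) *\<^sub>R complex_of_real (f x) - g x = 0"
  proof (rule AE_eq_0_if_test_functions)
    fix r :: real
    let ?B = "ball 0 r :: (real^'n) set"
    have "integrable lborel (\<lambda>x. indicator ?B x *\<^sub>R (?c * ?c) *\<^sub>R complex_of_real (f x))"
      using f by (intro integrable_mult_indicator integrable_scaleR_right integrable_of_real) auto
    moreover have "integrable lborel (\<lambda>x. indicator ?B x *\<^sub>R g x)"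
    proof (rule Bochner_Integration.integrable_bound)
      show "integrable lborel (\<lambda>x. indicator ?B x * L)"
        by (intro integrable_mult_left integrable_indicator_ball)
      show "AE x in lborel. norm (indicator ?B x *\<^sub>R g x) \<le> norm (indicator ?B x * L)"
        using order_trans[OF gL abs_ge_self] by (intro AE_I2) (auto simp: indicator_def)
    qed (use gm in \<open>auto intro!: borel_measurable_scaleR borel_measurable_indicator\<close>)
    ultimately show "integrable lborel (\<lambda>x. indicator ?B x *\<^sub>R ((?c * ?c) *\<^sub>R complex_of_real (f x) - g x))"
      unfolding scaleR_diff_right by (rule Bochner_Integration.integrable_diff)
  next
    fix \<phi> :: "real^'n \<Rightarrow> real"
    assume \<phi>: "continuous_on UNIV \<phi>" "\<And>x. \<bar>\<phi> x\<bar> \<le> 1" "\<exists>r. \<forall>x. x \<notin> ball 0 r \<longrightarrow> \<phi> x = 0"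
    then obtain r where r: "\<And>x. x \<notin> ball 0 r \<Longrightarrow> \<phi> x = 0" by blast
    have \<phi>m[measurable]: "\<phi> \<in> borel_measurable borel"
      using \<phi>(1) by (rule borel_measurable_continuous_onI)
    have \<phi>i: "integrable lborel \<phi>"
    proof (rule Bochner_Integration.integrable_bound)
      show "integrable lborel (indicator (ball 0 r :: (real^'n) set) :: _ \<Rightarrow> real)"
        by (rule integrable_indicator_ball)
      show "AE x in lborel. norm (\<phi> x) \<le> norm (indicator (ball 0 r) x :: real)"
        using \<phi>(2) r by (intro AE_I2) (auto simp: indicator_def)
    qed simp
    define M where "M n y = (\<integral>z. \<phi> (y + (1 / real (Suc n)) *\<^sub>R z) * gauss z \<partial>lborel)" for n y
    have Mm[measurable]: "M n \<in> borel_measurable borel" for n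
      unfolding M_def[abs_def] by (intro lborel.borel_measurable_lebesgue_integral) measurable
    have g1: "integral\<^sup>L lborel (gauss :: real^'n \<Rightarrow> real) = ?c"
      using integral_cis_gauss[of "0 :: real^'n"] by (simp add: gauss_def[of 0] flip: of_real_power of_real_mult)
    have bd: "norm (\<phi> (y + w *\<^sub>R z) * gauss z) \<le> gauss z" for y z w
      using \<phi>(2)[of "y + w *\<^sub>R z"] gauss_pos[of z] by (simp add: abs_mult mult_left_le_one_le)
    have Mle: "norm (M n y) \<le> ?c" for n y
    proof -
      have "integrable lborel (\<lambda>z. \<phi> (y + (1 / real (Suc n)) *\<^sub>R z) * gauss z)"
        by (rule Bochner_Integration.integrable_bound[OF integrable_gauss])
           (use order_trans[OF bd abs_ge_self] in auto)
      then show ?thesis unfolding M_def g1[symmetric]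
        by (intro order_trans[OF integral_norm_bound] integral_mono integrable_norm integrable_gauss bd)
    qed
    have Mlim: "(\<lambda>n. M n y) \<longlonglongrightarrow> \<phi> y * ?c" for y
    proof -
      have "(\<lambda>n. M n y) \<longlonglongrightarrow> (\<integral>z. \<phi> y * gauss (z :: real^'n) \<partial>lborel)"
        unfolding M_def
      proof (rule integral_dominated_convergence[where w="gauss :: real^'n \<Rightarrow> real"])
        show "AE z in lborel. (\<lambda>n. \<phi> (y + (1 / real (Suc n)) *\<^sub>R z) * gauss z) \<longlonglongrightarrow> \<phi> y * gauss z"
        proof (intro AE_I2 tendsto_mult tendsto_const)
          fix z :: "real^'n"
          have "isCont \<phi> y" using \<phi>(1) by (simp add: continuous_on_eq_continuous_at)
          moreover have "(\<lambda>n. y + (1 / real (Suc n)) *\<^sub>R z) \<longlonglongrightarrow> y"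
            using tendsto_add[OF tendsto_const tendsto_scaleR[OF e0 tendsto_const], of y z]
            by (simp only: scaleR_zero_left add_0_right)
          ultimately show "(\<lambda>n. \<phi> (y + (1 / real (Suc n)) *\<^sub>R z)) \<longlonglongrightarrow> \<phi> y"
            by (rule isCont_tendsto_compose)
        qed
      qed (use integrable_gauss bd in auto)
      then show ?thesis by (simp add: g1)
    qed
    have "(\<lambda>n. \<integral>x. \<phi> x *\<^sub>R A n x \<partial>lborel) \<longlonglongrightarrow> (\<integral>x. \<phi> x *\<^sub>R g x \<partial>lborel)"
    proof (rule integral_dominated_convergence[where w="\<lambda>x. \<bar>\<phi> x\<bar> * L"])
      show "AE x in lborel. (\<lambda>n. \<phi> x *\<^sub>R A n x) \<longlonglongrightarrow> \<phi> x *\<^sub>R g x"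
        by (intro AE_I2 tendsto_scaleR tendsto_const Alim)
      show "AE x in lborel. norm (\<phi> x *\<^sub>R A n x) \<le> \<bar>\<phi> x\<bar> * L" for n
        using AL by (intro AE_I2) (simp add: mult_left_mono)
      show "integrable lborel (\<lambda>x. \<bar>\<phi> x\<bar> * L)" using \<phi>i by (intro integrable_mult_left integrable_abs)
    qed measurable
    moreover have "(\<lambda>n. \<integral>x. \<phi> x *\<^sub>R A n x \<partial>lborel) \<longlonglongrightarrow> complex_of_real (?c * (\<integral>y. f y * (\<phi> y * ?c) \<partial>lborel))"
    proof -
      have "(\<lambda>n. \<integral>y. f y * M n y \<partial>lborel) \<longlonglongrightarrow> (\<integral>y. f y * (\<phi> y * ?c) \<partial>lborel)"
      proof (rule integral_dominated_convergence[where w="\<lambda>y. \<bar>f y\<bar> * ?c"])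
        show "AE y in lborel. (\<lambda>n. f y * M n y) \<longlonglongrightarrow> f y * (\<phi> y * ?c)"
          by (intro AE_I2 tendsto_mult tendsto_const Mlim)
        show "AE y in lborel. norm (f y * M n y) \<le> \<bar>f y\<bar> * ?c" for n
          using Mle by (intro AE_I2) (auto simp: abs_mult intro!: mult_left_mono)
        show "integrable lborel (\<lambda>y. \<bar>f y\<bar> * ?c)" using f by (intro integrable_mult_left integrable_abs)
      qed measurable
      moreover have "(\<integral>x. \<phi> x *\<^sub>R A n x \<partial>lborel) = complex_of_real (?c * (\<integral>y. f y * M n y \<partial>lborel))" for n
        unfolding A_def M_def by (rule fourier_gauss_mean[OF f \<phi>m \<phi>i \<phi>(2)]) simp
      ultimately show ?thesis
        by (simp only:) (intro tendsto_of_real tendsto_mult tendsto_const)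
    qed
    ultimately have lim: "(\<integral>x. \<phi> x *\<^sub>R g x \<partial>lborel) = complex_of_real (?c * (\<integral>y. f y * (\<phi> y * ?c) \<partial>lborel))"
      by (rule LIMSEQ_unique)
    have i1: "integrable lborel (\<lambda>x. complex_of_real (?c * (f x * (\<phi> x * ?c))))"
    proof (intro integrable_of_real integrable_mult_right)
      have "integrable lborel (\<lambda>x. f x * \<phi> x)"
        by (rule Bochner_Integration.integrable_bound[OF f])
           (use \<phi>(2) in \<open>auto simp: abs_mult mult_left_le\<close>)
      then show "integrable lborel (\<lambda>x. f x * (\<phi> x * ?c))"
        unfolding mult.assoc[symmetric] by (rule integrable_mult_left)
    qed
    have i2: "integrable lborel (\<lambda>x. \<phi> x *\<^sub>R g x)"
    proof (rule Bochner_Integration.integrable_bound)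
      show "integrable lborel (\<lambda>x. \<phi> x * L)" using \<phi>i by (intro integrable_mult_left)
      show "AE x in lborel. norm (\<phi> x *\<^sub>R g x) \<le> norm (\<phi> x * L)"
        using order_trans[OF gL abs_ge_self] by (intro AE_I2) (auto simp: abs_mult mult_left_mono)
    qed measurable
    have "(\<integral>x. \<phi> x *\<^sub>R ((?c * ?c) *\<^sub>R complex_of_real (f x) - g x) \<partial>lborel)
        = (\<integral>x. complex_of_real (?c * (f x * (\<phi> x * ?c))) - \<phi> x *\<^sub>R g x \<partial>lborel)"
      by (intro Bochner_Integration.integral_cong refl) (simp add: scaleR_conv_of_real algebra_simps)
    also have "\<dots> = (\<integral>x. complex_of_real (?c * (f x * (\<phi> x * ?c))) \<partial>lborel) - (\<integral>x. \<phi> x *\<^sub>R g x \<partial>lborel)"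
      by (rule Bochner_Integration.integral_diff[OF i1 i2])
    also have "\<dots> = 0"
      unfolding lim integral_complex_of_real integral_mult_right_zero by simp
    finally show "(\<integral>x. \<phi> x *\<^sub>R ((?c * ?c) *\<^sub>R complex_of_real (f x) - g x) \<partial>lborel) = 0" .
  qed
  then show ?thesis
  proof eventually_elim
    case (elim x)
    then have "complex_of_real ((2 * pi) ^ CARD('n)) * complex_of_real (f x) = g x"
      by (simp add: cc scaleR_conv_of_real)
    then show ?case by (simp add: g_def field_simps)
  qed
qed

section \<open>The convolution kernel on odd functions\<close>

lemma reflN_component [simp]: "reflN k x $ i = (if i = k then - (x $ i) else x $ i)"
  by (simp add: reflN_def)

lemma reflN_reflN [simp]: "reflN k (reflN k x) = x"
  by (simp add: vec_eq_iff)

lemma reflN_diff: "reflN k (x - y) = reflN k x - reflN k y"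
  by (simp add: vec_eq_iff)

lemma reflN_eq_self: "x $ k = 0 \<Longrightarrow> reflN k x = x"
  by (auto simp: vec_eq_iff)

lemma continuous_on_reflN [continuous_intros]:
  "continuous_on S f \<Longrightarrow> continuous_on S (\<lambda>x. reflN k (f x))" for f :: "_ \<Rightarrow> real^'n::finite"
  unfolding reflN_def
proof (intro continuous_on_vec_lambda)
  show "continuous_on S (\<lambda>x. if i = k then - f x $ i else f x $ i)" if "continuous_on S f" for i
    using that by (cases "i = k") (auto intro!: continuous_intros)
qed

lemma borel_measurable_reflN [measurable]: "reflN k \<in> borel_measurable (borel :: (real^'n::finite) measure)"
  by (intro borel_measurable_continuous_onI continuous_on_reflN continuous_on_id)

text \<open>The reflection is diagonal with entries 1 and -1, so its Jacobian has modulus 1.\<close>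

lemma lborel_distr_reflN: "distr lborel borel (reflN k) = (lborel :: (real^'n::finite) measure)"
proof -
  let ?c = "\<lambda>j :: real^'n. if j = axis k 1 then -1 else (1::real)"
  have T: "(\<lambda>x. 0 + (\<Sum>j\<in>Basis. (?c j * (x \<bullet> j)) *\<^sub>R j)) = reflN k"
  proof
    fix x :: "real^'n"
    show "0 + (\<Sum>j\<in>Basis. (?c j * (x \<bullet> j)) *\<^sub>R j) = reflN k x"
    proof (rule euclidean_eqI)
      fix b :: "real^'n" assume b: "b \<in> Basis"
      then obtain i where i: "b = axis i 1" by (auto simp: Basis_vec_def)
      have "(0 + (\<Sum>j\<in>Basis. (?c j * (x \<bullet> j)) *\<^sub>R j)) \<bullet> b = ?c b * (x \<bullet> b)"
        using b by (simp add: inner_sum_left inner_Basis if_distrib cong: if_cong)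
      also have "\<dots> = reflN k x \<bullet> b"
        by (auto simp: i inner_axis axis_eq_axis)
      finally show "(0 + (\<Sum>j\<in>Basis. (?c j * (x \<bullet> j)) *\<^sub>R j)) \<bullet> b = reflN k x \<bullet> b" .
    qed
  qed
  have c: "(\<Prod>j\<in>Basis. \<bar>?c j\<bar>) = (1::real)"
    by (intro prod.neutral) auto
  have "(lborel :: (real^'n) measure) = density (distr lborel borel (\<lambda>x. 0 + (\<Sum>j\<in>Basis. (?c j * (x \<bullet> j)) *\<^sub>R j))) (\<lambda>_. (\<Prod>j\<in>Basis. \<bar>?c j\<bar>))"
    by (rule lborel_affine_euclidean[of ?c 0]) auto
  then show ?thesis unfolding T c by (simp add: density_1)
qed

lemma borel_halfspace [measurable]: "halfspace k \<in> sets (borel :: (real^'n::finite) measure)"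
  unfolding halfspace_def by measurable

lemma open_halfspace: "open (halfspace k :: (real^'n::finite) set)"
  unfolding halfspace_def by (intro open_Collect_less continuous_intros)

lemma reflN_in_halfspace: "x $ k < 0 \<Longrightarrow> reflN k x \<in> halfspace k"
  by (simp add: halfspace_def)

lemma oddext_reflN: "oddext k f (reflN k x) = - oddext k f x"
  by (auto simp: oddext_def)

lemma oddext_eq: "oddext k f x = indicator (halfspace k) x * f x - indicator (halfspace k) (reflN k x) * f (reflN k x)"
  by (auto simp: oddext_def halfspace_def indicator_def)

lemma borel_measurable_oddext [measurable]:
  fixes f :: "real^'n::finite \<Rightarrow> real"
  assumes [measurable]: "f \<in> borel_measurable borel"
  shows "oddext k f \<in> borel_measurable borel"
  unfolding oddext_eq[abs_def] by measurable

text \<open>The hyperplane belongs to neither half, but there the reflection is the identity and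
  oddness forces the value 0.\<close>

lemma odd_eq:
  fixes f :: "real^'n::finite \<Rightarrow> real"
  assumes "\<And>x. f (reflN k x) = - f x"
  shows "f x = indicator (halfspace k) x * f x - indicator (halfspace k) (reflN k x) * f (reflN k x)"
proof -
  have "f x = 0" if "x $ k = 0" using assms[of x] reflN_eq_self[OF that] by simp
  then show ?thesis using assms[of x] by (cases "x $ k" "0::real" rule: linorder_cases) (auto simp: indicator_def halfspace_def)
qed

lemma (in finite_measure) tendsto_integral_open_indicator:
  fixes f :: "nat \<Rightarrow> 'a \<Rightarrow> real"
  assumes "\<And>n. f n \<in> borel_measurable M" "U \<in> sets M"
    "\<And>n x. 0 \<le> f n x" "\<And>n x. f n x \<le> 1" "\<And>x. (\<lambda>n. f n x) \<longlonglongrightarrow> indicator U x"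
  shows "(\<lambda>n. \<integral>x. f n x \<partial>M) \<longlonglongrightarrow> measure M U"
proof -
  have "(\<lambda>n. \<integral>x. f n x \<partial>M) \<longlonglongrightarrow> (\<integral>x. indicator U x \<partial>M)"
    by (rule integral_dominated_convergence[where w="\<lambda>_. 1"]) (use assms in auto)
  then show ?thesis using assms(2) by simp
qed

text \<open>Open sets generate the Borel sets and are stable under intersection, and their
  indicators are limits of continuous functions. It turns evenness, which is assumed only through
  continuous test functions, into invariance of the measure.\<close>

lemma finite_measure_eqI_continuous:
  fixes M N :: "'a::metric_space measure"
  assumes "finite_measure M" "finite_measure N" and sets: "sets M = sets borel" "sets N = sets borel"
    and eq: "\<And>f :: 'a \<Rightarrow> real. continuous_on UNIV f \<Longrightarrow> bounded (range f) \<Longrightarrow> (\<integral>x. f x \<partial>M) = (\<integral>x. f x \<partial>N)"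
  shows "M = N"
proof -
  interpret M: finite_measure M by fact
  interpret N: finite_measure N by fact
  have *: "emeasure M U = emeasure N U" if U: "open U" for U
  proof -
    obtain f where f: "\<And>n. continuous_on UNIV (f n)" "\<And>n x. 0 \<le> f n x" "\<And>n x. f n x \<le> (1::real)"
      "\<And>n x. x \<notin> U \<Longrightarrow> f n x = 0" "\<And>x. (\<lambda>n. f n x) \<longlonglongrightarrow> indicator U x"
      by (rule open_indicator_approx[OF U]) blast
    have m: "f n \<in> borel_measurable borel" for n using f(1) by (rule borel_measurable_continuous_onI)
    have "bounded (range (f n))" for n
      using f(2,3)[where n=n] by (auto intro!: boundedI[where B=1])
    then have e: "(\<integral>x. f n x \<partial>M) = (\<integral>x. f n x \<partial>N)" for n using eq f(1) by blast
    have "(\<lambda>n. \<integral>x. f n x \<partial>M) \<longlonglongrightarrow> measure M U"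
      by (rule M.tendsto_integral_open_indicator) (use f m U sets in \<open>auto cong: measurable_cong_sets\<close>)
    moreover have "(\<lambda>n. \<integral>x. f n x \<partial>N) \<longlonglongrightarrow> measure N U"
      by (rule N.tendsto_integral_open_indicator) (use f m U sets in \<open>auto cong: measurable_cong_sets\<close>)
    ultimately have "measure M U = measure N U" unfolding e by (rule LIMSEQ_unique)
    then show ?thesis by (simp add: M.emeasure_eq_measure N.emeasure_eq_measure)
  qed
  show ?thesis
  proof (rule measure_eqI_generator_eq[where E="{S. open S}" and \<Omega>=UNIV and A="\<lambda>_. UNIV"])
    show "Int_stable {S :: 'a set. open S}" by (auto simp: Int_stable_def)
  qed (use * sets in \<open>auto simp: borel_def\<close>)
qed

section \<open>Measurability, symmetry and positivity of the kernel\<close>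

locale half_space_kernel =
  fixes k :: "'n::finite" and G :: "real \<Rightarrow> (real^'n) measure"
  assumes G_meas: "\<And>t. 0 < t \<Longrightarrow> sets (G t) = sets borel \<and> emeasure (G t) (space (G t)) = 1"
    and G_cont: "\<And>f :: real^'n \<Rightarrow> real. continuous_on UNIV f \<Longrightarrow> bounded (range f)
                   \<Longrightarrow> continuous_on {0<..} (\<lambda>t. \<integral> x. f x \<partial>G t)"
    and G_evenN: "\<And>t f. 0 < t \<Longrightarrow> continuous_on UNIV f \<Longrightarrow> bounded (range f)
                   \<Longrightarrow> (\<And>x. f (reflN k x) = - f x) \<Longrightarrow> (\<integral> x. f x \<partial>G t) = (0::real)"
    and comp_lin: "\<And>v0 w0 t. half_data k v0 \<Longrightarrow> half_data k w0
                     \<Longrightarrow> (AE x in lborel. x \<in> halfspace k \<longrightarrow> v0 x \<le> w0 x) \<Longrightarrow> 0 < t \<Longrightarrow>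
                     (AE x in lborel. x \<in> halfspace k \<longrightarrow>
                        conv (G t) (oddext k v0) x \<le> conv (G t) (oddext k w0) x)"
begin

text \<open>\<open>G\<close> is unconstrained at \<open>t \<le> 0\<close>; the Dirac measure makes the Duhamel integrand well-behaved at \<open>s = t\<close> too.\<close>
definition K :: "real \<Rightarrow> (real^'n) measure" where
  "K t = (if 0 < t then G t else return borel 0)"

lemma sets_K [simp, measurable_cong]: "sets (K t) = sets borel"
  using G_meas[of t] by (simp add: K_def)

lemma space_K [simp]: "space (K t) = UNIV"
  using sets_eq_imp_space_eq[OF sets_K, of t] by simp

lemma prob_space_K: "prob_space (K t)"
  using G_meas[of t] by (auto simp: K_def intro!: prob_space_return prob_spaceI)

lemma finite_measure_K: "finite_measure (K t)"
  using prob_space_K by (rule prob_space.finite_measure)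

text \<open>Only integrals of bounded continuous functions are known to depend continuously on time.
  Masses of open sets are limits of such integrals, hence measurable in time, and open sets form a
  generator stable under intersection.\<close>

lemma K_measurable [measurable]: "K \<in> borel \<rightarrow>\<^sub>M subprob_algebra borel"
proof (rule measurable_subprob_algebra_generated[where G="{S. open S}" and \<Omega>=UNIV])
  show "Int_stable {S :: (real^'n) set. open S}" by (auto simp: Int_stable_def)
  show "subprob_space (K t)" for t
    using prob_space_K by (rule prob_space_imp_subprob_space)
  have em: "(\<lambda>t. emeasure (K t) U) \<in> borel_measurable borel" if U: "open U" for U
  proof -
    obtain f where f: "\<And>n. continuous_on UNIV (f n)" "\<And>n x. 0 \<le> f n x" "\<And>n x. f n x \<le> (1::real)"
      "\<And>n x. x \<notin> U \<Longrightarrow> f n x = 0" "\<And>x. (\<lambda>n. f n x) \<longlonglongrightarrow> indicator U x"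
      by (rule open_indicator_approx[OF U]) blast
    have m[measurable]: "f n \<in> borel_measurable borel" for n using f(1) by (rule borel_measurable_continuous_onI)
    have b: "bounded (range (f n))" for n
      using f(2,3)[where n=n] by (auto intro!: boundedI[where B=1])
    have "(\<lambda>t. measure (K t) U) \<in> borel_measurable borel"
    proof (rule borel_measurable_LIMSEQ_metric)
      fix n
      \<comment> \<open>The value \<open>f n 0\<close> for other times is the integral against the
        Dirac measure at 0.\<close>
      have "(\<lambda>t. if t \<in> {0<..} then \<integral>x. f n x \<partial>G t else f n 0) \<in> borel_measurable borel"
        by (intro borel_measurable_continuous_on_if G_cont f(1) b) auto
      also have "(\<lambda>t. if t \<in> {0<..} then \<integral>x. f n x \<partial>G t else f n 0) = (\<lambda>t. \<integral>x. f n x \<partial>K t)"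
        by (auto simp: K_def integral_return)
      finally show "(\<lambda>t. \<integral>x. f n x \<partial>K t) \<in> borel_measurable borel" .
    next
      fix t
      interpret finite_measure "K t" by (rule finite_measure_K)
      show "(\<lambda>n. \<integral>x. f n x \<partial>K t) \<longlonglongrightarrow> measure (K t) U"
        by (rule tendsto_integral_open_indicator) (use f U in auto)
    qed
    then have "(\<lambda>t. ennreal (measure (K t) U)) \<in> borel_measurable borel" by measurable
    then show ?thesis by (simp add: finite_measure.emeasure_eq_measure[OF finite_measure_K])
  qed
  show "(\<lambda>t. emeasure (K t) U) \<in> borel_measurable borel" if "U \<in> {S. open S}" for U
    using em that by auto
  show "(\<lambda>t. emeasure (K t) UNIV) \<in> borel_measurable borel"
    using em[of UNIV] by simp
qed (auto simp: borel_def)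

text \<open>Kernel and integrand both depend on the parameter. Pushing \<open>K (r w)\<close>
  forward along \<open>Pair w\<close> places the parameter dependence in the measure alone, so that
  one fixed function is integrated against a measurable family of measures.\<close>

lemma borel_measurable_conv_K:
  assumes f[measurable]: "(\<lambda>(w, z). f w z) \<in> borel_measurable (M \<Otimes>\<^sub>M borel)"
    and r[measurable]: "r \<in> borel_measurable M" and x[measurable]: "x \<in> borel_measurable M"
  shows "(\<lambda>w. conv (K (r w)) (f w) (x w)) \<in> borel_measurable M"
proof -
  have k[measurable]: "(\<lambda>w. K (r w)) \<in> M \<rightarrow>\<^sub>M subprob_algebra borel"
    using measurable_compose[OF r K_measurable] .
  have "(\<lambda>w. distr (K (r w)) (M \<Otimes>\<^sub>M borel) (Pair w)) \<in> M \<rightarrow>\<^sub>M subprob_algebra (M \<Otimes>\<^sub>M borel)"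
    by (rule measurable_distr2[OF _ k]) simp
  moreover have fm: "(\<lambda>(w, y). f w (x w - y)) \<in> borel_measurable (M \<Otimes>\<^sub>M borel)"
    by measurable
  ultimately have "(\<lambda>w. \<integral>p. (case p of (w, y) \<Rightarrow> f w (x w - y)) \<partial>distr (K (r w)) (M \<Otimes>\<^sub>M borel) (Pair w)) \<in> borel_measurable M"
    by (intro measurable_compose[OF _ integral_measurable_subprob_algebra])
  then show ?thesis
  proof (rule measurable_cong[THEN iffD1, rotated])
    fix w assume w: "w \<in> space M"
    have "Pair w \<in> K (r w) \<rightarrow>\<^sub>M M \<Otimes>\<^sub>M borel"
      using w by (intro measurable_Pair) auto
    then show "(\<integral>p. (case p of (w, y) \<Rightarrow> f w (x w - y)) \<partial>distr (K (r w)) (M \<Otimes>\<^sub>M borel) (Pair w)) = conv (K (r w)) (f w) (x w)"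
      unfolding conv_def by (subst integral_distr[OF _ fm]) auto
  qed
qed

text \<open>The difference of \<open>f\<close> and its reflection is odd, so \<open>G_evenN\<close>
  annihilates it.\<close>

lemma distr_K_reflN: "distr (K t) borel (reflN k) = K t"
proof (cases "0 < t")
  case True
  show ?thesis
  proof (rule finite_measure_eqI_continuous)
    show "finite_measure (distr (K t) borel (reflN k))"
      by (intro finite_measure.finite_measure_distr finite_measure_K) simp
    fix f :: "real^'n \<Rightarrow> real" assume f: "continuous_on UNIV f" "bounded (range f)"
    have fm[measurable]: "f \<in> borel_measurable borel" using f(1) by (rule borel_measurable_continuous_onI)
    obtain B where B: "\<And>x. \<bar>f x\<bar> \<le> B" using f(2) by (auto simp: bounded_iff)
    have i: "integrable (K t) (\<lambda>x. f (g x))" if [measurable]: "g \<in> borel_measurable borel" for g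
      by (intro finite_measure.integrable_const_bound[OF finite_measure_K, where B=B]) (use B in auto)
    have "(\<integral>x. f x - f (reflN k x) \<partial>G t) = 0"
    proof (rule G_evenN[OF True])
      have "continuous_on UNIV (\<lambda>x. f (reflN k x))"
        by (intro continuous_on_compose2[OF f(1)] continuous_intros) auto
      then show "continuous_on UNIV (\<lambda>x. f x - f (reflN k x))" by (intro continuous_intros f)
      show "bounded (range (\<lambda>x. f x - f (reflN k x)))"
      proof (rule boundedI[where B="B + B"], clarify)
        show "norm (f x - f (reflN k x)) \<le> B + B" for x
          using B[of x] B[of "reflN k x"] by (simp only: real_norm_def)
      qed
    qed simp
    then have "(\<integral>x. f x - f (reflN k x) \<partial>K t) = 0" using True by (simp add: K_def)
    then have "(\<integral>x. f x \<partial>K t) = (\<integral>x. f (reflN k x) \<partial>K t)"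
      by (subst (asm) Bochner_Integration.integral_diff) (use i[of "\<lambda>x. x"] i[of "reflN k"] in auto)
    then show "(\<integral>x. f x \<partial>distr (K t) borel (reflN k)) = (\<integral>x. f x \<partial>K t)"
      by (subst integral_distr) auto
  qed (auto simp: finite_measure_K)
next
  case False
  then show ?thesis
    by (simp add: K_def distr_return reflN_eq_self)
qed

lemma conv_K_odd:
  fixes f :: "real^'n \<Rightarrow> real"
  assumes [measurable]: "f \<in> borel_measurable borel" and odd: "\<And>x. f (reflN k x) = - f x"
  shows "conv (K t) f (reflN k x) = - conv (K t) f x"
proof -
  have "conv (K t) f (reflN k x) = (\<integral>y. f (reflN k x - y) \<partial>distr (K t) borel (reflN k))"
    by (simp add: conv_def distr_K_reflN)
  also have "\<dots> = (\<integral>y. f (reflN k (x - y)) \<partial>K t)"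
    by (subst integral_distr) (auto simp: reflN_diff)
  also have "\<dots> = - conv (K t) f x"
    by (simp add: odd conv_def)
  finally show ?thesis .
qed

lemma integrable_conv_K:
  fixes f :: "real^'n \<Rightarrow> real"
  assumes [measurable]: "f \<in> borel_measurable borel" and B: "\<And>x. \<bar>f x\<bar> \<le> B"
  shows "integrable (K t) (\<lambda>y. f (x - y))"
  by (intro finite_measure.integrable_const_bound[OF finite_measure_K, where B=B]) (use B in auto)

lemma conv_K_bound:
  fixes f :: "real^'n \<Rightarrow> real"
  assumes [measurable]: "f \<in> borel_measurable borel" and B: "\<And>x. \<bar>f x\<bar> \<le> B"
  shows "\<bar>conv (K t) f x\<bar> \<le> B"
proof -
  interpret prob_space "K t" by (rule prob_space_K)
  have "\<bar>conv (K t) f x\<bar> \<le> (\<integral>y. \<bar>f (x - y)\<bar> \<partial>K t)"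
    unfolding conv_def by (rule integral_abs_bound)
  also have "\<dots> \<le> (\<integral>y. B \<partial>K t)"
    using integrable_conv_K[OF assms] B by (intro integral_mono) auto
  finally show ?thesis using prob_space by simp
qed

lemma continuous_on_conv_K:
  fixes f :: "real^'n \<Rightarrow> real"
  assumes f: "continuous_on UNIV f" and B: "\<And>x. \<bar>f x\<bar> \<le> B"
  shows "continuous_on UNIV (conv (K t) f)"
proof -
  have [measurable]: "f \<in> borel_measurable borel" using f by (rule borel_measurable_continuous_onI)
  interpret prob_space "K t" by (rule prob_space_K)
  show ?thesis
    unfolding continuous_on_sequentially
  proof (intro allI ballI impI)
    fix x :: "nat \<Rightarrow> real^'n" and a assume "(\<forall>n. x n \<in> UNIV) \<and> x \<longlonglongrightarrow> a"
    then have x: "x \<longlonglongrightarrow> a" by simp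
    have "(\<lambda>n. \<integral>y. f (x n - y) \<partial>K t) \<longlonglongrightarrow> (\<integral>y. f (a - y) \<partial>K t)"
    proof (rule integral_dominated_convergence[where w="\<lambda>_. B"])
      show "AE y in K t. (\<lambda>n. f (x n - y)) \<longlonglongrightarrow> f (a - y)"
      proof (intro AE_I2)
        fix y
        have "isCont f (a - y)" using f by (simp add: continuous_on_eq_continuous_at)
        then show "(\<lambda>n. f (x n - y)) \<longlonglongrightarrow> f (a - y)"
          by (rule isCont_tendsto_compose) (intro tendsto_diff x tendsto_const)
      qed
    qed (use B in auto)
    then show "(conv (K t) f \<circ> x) \<longlonglongrightarrow> conv (K t) f a" by (simp add: conv_def comp_def)
  qed
qed

end

text \<open>By continuity a violation at one point spreads to a nonempty open set, which is never
  Lebesgue-null.\<close>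

lemma AE_lborel_open_continuous_nonneg:
  fixes f :: "'a::euclidean_space \<Rightarrow> real"
  assumes U: "open U" and f: "continuous_on U f" and ae: "AE x in lborel. x \<in> U \<longrightarrow> 0 \<le> f x" and x: "x \<in> U"
  shows "0 \<le> f x"
proof (rule ccontr)
  assume "\<not> 0 \<le> f x"
  define V where "V = {y \<in> U. f y < 0}"
  have V: "open V" unfolding V_def
    using continuous_on_open_vimage[OF U, of f] f
    by (auto simp: vimage_def Int_def conj_commute dest!: spec[where x="{..<0}"])
  have "AE y in lborel. y \<notin> V" using ae by eventually_elim (auto simp: V_def)
  then have "V \<in> null_sets lborel" using V by (subst AE_iff_null_sets) auto
  then have "V = {}" using V by (meson negligible_iff_null_sets null_sets_completionI open_not_negligible)
  moreover have "x \<in> V" using x \<open>\<not> 0 \<le> f x\<close> by (simp add: V_def)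
  ultimately show False by simp
qed

context half_space_kernel
begin

text \<open>The linear comparison principle against the zero datum. Bounded support makes
  \<open>f\<close> admissible as a datum, and support inside the half space makes its odd extension
  equal to \<open>f\<close> minus its reflection. Continuity of the convolution upgrades almost
  every point to the given \<open>x\<close>, which stays fixed in the measure inequality
  below.\<close>

lemma conv_K_test_nonneg:
  fixes f :: "real^'n \<Rightarrow> real"
  assumes f: "continuous_on UNIV f" "\<And>x. 0 \<le> f x" "\<And>x. f x \<le> 1" "\<And>x. x \<notin> V \<Longrightarrow> f x = 0"
    and V: "V \<subseteq> halfspace k \<inter> ball 0 r" and t: "0 < t" and x: "x \<in> halfspace k"
  shows "0 \<le> conv (K t) (\<lambda>x. f x - f (reflN k x)) x"
proof -
  have [measurable]: "f \<in> borel_measurable borel" using f(1) by (rule borel_measurable_continuous_onI)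
  have f0: "f x = 0" if "x \<notin> halfspace k" for x using f(4) V that by blast
  have od: "oddext k f = (\<lambda>x. f x - f (reflN k x))"
    unfolding oddext_eq[abs_def] using f0 by (auto simp: fun_eq_iff indicator_def)
  have od0: "oddext k (\<lambda>_. 0) = (\<lambda>_. 0)" by (auto simp: oddext_def fun_eq_iff)
  have "half_data k f"
    unfolding half_data_def set_integrable_def
  proof (intro conjI)
    show "integrable lborel (\<lambda>x. indicator (halfspace k) x *\<^sub>R f x)"
    proof (rule Bochner_Integration.integrable_bound[OF integrable_indicator_ball[of 0 r]])
      show "AE x in lborel. norm (indicator (halfspace k) x *\<^sub>R f x) \<le> norm (indicator (ball 0 r) x :: real)"
      proof (intro AE_I2)
        fix x
        have "\<bar>f x\<bar> \<le> indicator (ball 0 r) x"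
          using f(2,3)[of x] f(4)[of x] V by (cases "x \<in> V") (auto simp: indicator_def)
        then show "norm (indicator (halfspace k) x *\<^sub>R f x) \<le> norm (indicator (ball 0 r) x :: real)"
          by (auto simp: indicator_def)
      qed
    qed simp
    show "\<exists>M. AE x in lborel. x \<in> halfspace k \<longrightarrow> \<bar>f x\<bar> \<le> M"
      using f(2,3) by (intro exI[of _ 1]) auto
  qed simp
  moreover have "half_data k (\<lambda>_. 0)" by (auto simp: half_data_def set_integrable_def)
  ultimately have "AE x in lborel. x \<in> halfspace k \<longrightarrow>
      conv (G t) (oddext k (\<lambda>_. 0)) x \<le> conv (G t) (oddext k f) x"
    using f(2) t by (intro comp_lin) auto
  then have ae: "AE x in lborel. x \<in> halfspace k \<longrightarrow> 0 \<le> conv (K t) (\<lambda>x. f x - f (reflN k x)) x"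
    unfolding od od0 using t by (simp add: K_def) (simp add: conv_def)
  have "continuous_on UNIV (\<lambda>x. f x - f (reflN k x))"
    by (intro continuous_intros f continuous_on_compose2[OF f(1)]) auto
  moreover have "\<bar>f x - f (reflN k x)\<bar> \<le> 1" for x
    using f(2,3)[of x] f(2,3)[of "reflN k x"] by linarith
  ultimately have "continuous_on UNIV (conv (K t) (\<lambda>x. f x - f (reflN k x)))"
    by (rule continuous_on_conv_K)
  then show ?thesis
    by (intro AE_lborel_open_continuous_nonneg[OF open_halfspace _ ae x]) (rule continuous_on_subset, auto)
qed

text \<open>The comparison principle as a property of the kernel alone: from a point of the half
  space, jumps into a set outweigh jumps into its mirror image. It passes from test functions to
  bounded open sets by limits, to bounded Borel sets by outer regularity, and to all Borel sets by
  exhaustion with balls.\<close>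

lemma emeasure_K_reflN_le:
  assumes t: "0 < t" and x: "x \<in> halfspace k" and A: "A \<in> sets borel" "A \<subseteq> halfspace k"
  shows "emeasure (distr (K t) borel (\<lambda>y. reflN k (x - y))) A \<le> emeasure (distr (K t) borel (\<lambda>y. x - y)) A"
    (is "emeasure ?N A \<le> emeasure ?M A")
proof -
  interpret K: prob_space "K t" by (rule prob_space_K)
  interpret M: finite_measure ?M by (intro K.finite_measure_distr) simp
  interpret N: finite_measure ?N by (intro K.finite_measure_distr) simp
  have op: "emeasure ?N V \<le> emeasure ?M V" if V: "open V" "V \<subseteq> halfspace k \<inter> ball 0 r" for V r
  proof -
    obtain f where f: "\<And>n. continuous_on UNIV (f n)" "\<And>n x. 0 \<le> f n x" "\<And>n x. f n x \<le> (1::real)"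
      "\<And>n x. x \<notin> V \<Longrightarrow> f n x = 0" "\<And>x. (\<lambda>n. f n x) \<longlonglongrightarrow> indicator V x"
      by (rule open_indicator_approx[OF V(1)]) blast
    have m[measurable]: "f n \<in> borel_measurable borel" for n using f(1) by (rule borel_measurable_continuous_onI)
    have le: "(\<integral>z. f n z \<partial>?N) \<le> (\<integral>z. f n z \<partial>?M)" for n
    proof -
      have i: "integrable (K t) (\<lambda>y. f n (g y))" if [measurable]: "g \<in> borel_measurable borel" for g
        by (rule K.integrable_const_bound[where B=1]) (use f(2,3) in auto)
      have "0 \<le> conv (K t) (\<lambda>x. f n x - f n (reflN k x)) x"
        by (rule conv_K_test_nonneg[OF f(1-4) V(2) t x])
      also have "\<dots> = (\<integral>y. f n (x - y) \<partial>K t) - (\<integral>y. f n (reflN k (x - y)) \<partial>K t)"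
        unfolding conv_def by (intro Bochner_Integration.integral_diff i) auto
      finally show ?thesis by (subst (1 2) integral_distr) auto
    qed
    have "(\<lambda>n. \<integral>z. f n z \<partial>?N) \<longlonglongrightarrow> measure ?N V"
      by (rule N.tendsto_integral_open_indicator) (use f V in auto)
    moreover have "(\<lambda>n. \<integral>z. f n z \<partial>?M) \<longlonglongrightarrow> measure ?M V"
      by (rule M.tendsto_integral_open_indicator) (use f V in auto)
    ultimately have "measure ?N V \<le> measure ?M V"
      using le by (intro LIMSEQ_le) auto
    then show ?thesis by (simp add: M.emeasure_eq_measure N.emeasure_eq_measure)
  qed
  have bdd: "emeasure ?N A' \<le> emeasure ?M A'"
    if A': "A' \<in> sets borel" "A' \<subseteq> halfspace k \<inter> ball 0 r" for A' r
  proof -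
    have "emeasure ?M A' = (INF U \<in> {U. A' \<subseteq> U \<and> open U}. emeasure ?M U)"
      by (rule outer_regular) (use A' M.emeasure_finite in auto)
    also have "\<dots> \<ge> emeasure ?N A'"
    proof (rule INF_greatest)
      fix U assume U: "U \<in> {U. A' \<subseteq> U \<and> open U}"
      let ?V = "U \<inter> (halfspace k \<inter> ball 0 r)"
      have V: "open ?V" using U open_halfspace by (auto intro!: open_Int)
      have "emeasure ?N A' \<le> emeasure ?N ?V" using U A' V by (intro emeasure_mono) auto
      also have "\<dots> \<le> emeasure ?M ?V" by (rule op[OF V]) auto
      also have "\<dots> \<le> emeasure ?M U" using U by (intro emeasure_mono) auto
      finally show "emeasure ?N A' \<le> emeasure ?M U" .
    qed
    finally show ?thesis .
  qed
  have U: "(\<Union>n::nat. A \<inter> ball 0 (real n)) = A"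
  proof -
    have "\<exists>n::nat. y \<in> ball 0 (real n)" for y :: "real^'n" using reals_Archimedean2[of "norm y"] by auto
    then show ?thesis by blast
  qed
  have inc: "incseq (\<lambda>n::nat. A \<inter> ball 0 (real n))" by (auto simp: incseq_def)
  have "(SUP n::nat. emeasure ?N (A \<inter> ball 0 (real n))) = emeasure ?N (\<Union>n::nat. A \<inter> ball 0 (real n))"
    using A by (intro SUP_emeasure_incseq[OF _ inc]) auto
  moreover have "(SUP n::nat. emeasure ?M (A \<inter> ball 0 (real n))) = emeasure ?M (\<Union>n::nat. A \<inter> ball 0 (real n))"
    using A by (intro SUP_emeasure_incseq[OF _ inc]) auto
  moreover have "(SUP n::nat. emeasure ?N (A \<inter> ball 0 (real n))) \<le> (SUP n::nat. emeasure ?M (A \<inter> ball 0 (real n)))"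
    using A by (intro SUP_mono') (rule bdd, auto)
  ultimately show ?thesis unfolding U by (simp only:)
qed

text \<open>With \<open>h\<close> the part of \<open>f\<close> on the half space, \<open>f\<close>
  is \<open>h\<close> minus the reflection of \<open>h\<close>, and the measure inequality compares
  the two integrals. This frees the comparison principle from integrable data and from exceptional
  null sets, as the Duhamel sources, known only to be bounded, require.\<close>

theorem conv_K_nonneg:
  fixes f :: "real^'n \<Rightarrow> real"
  assumes [measurable]: "f \<in> borel_measurable borel" and B: "\<And>x. \<bar>f x\<bar> \<le> B"
    and odd: "\<And>x. f (reflN k x) = - f x" and pos: "\<And>x. x \<in> halfspace k \<Longrightarrow> 0 \<le> f x"
    and x: "x \<in> halfspace k"
  shows "0 \<le> conv (K t) f x"
proof (cases "0 < t")
  case False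
  then show ?thesis using pos[OF x] by (simp add: conv_def K_def integral_return)
next
  case t: True
  interpret K: prob_space "K t" by (rule prob_space_K)
  let ?M = "distr (K t) borel (\<lambda>y. x - y)" and ?N = "distr (K t) borel (\<lambda>y. reflN k (x - y))"
  let ?H = "halfspace k :: (real^'n) set"
  define h where "h z = indicator ?H z * f z" for z
  have [measurable]: "h \<in> borel_measurable borel" unfolding h_def[abs_def] by measurable
  have h0: "0 \<le> h z" for z using pos by (auto simp: h_def indicator_def)
  have hB: "\<bar>h z\<bar> \<le> B" for z using B[of z] by (auto simp: h_def indicator_def)
  have i: "integrable (K t) (\<lambda>y. h (g y))" if [measurable]: "g \<in> borel_measurable borel" for g
    by (rule K.integrable_const_bound[where B=B]) (use hB in auto)
  \<comment> \<open>The inequality holds only for subsets of the half space; restricting both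
    measures by a density makes it a genuine order between measures.\<close>
  have le: "density ?N (indicator ?H) \<le> density ?M (indicator ?H)"
  proof (rule le_measure[THEN iffD2], simp, intro ballI)
    fix A assume "A \<in> sets (density ?N (indicator ?H))"
    then have A: "A \<in> sets borel" by simp
    have "emeasure (density L (indicator ?H)) A = emeasure L (?H \<inter> A)" if "sets L = sets borel" for L
      using A that by (subst emeasure_density)
        (auto simp: indicator_inter_arith[symmetric] cong: measurable_cong_sets intro!: nn_integral_indicator)
    then show "emeasure (density ?N (indicator ?H)) A \<le> emeasure (density ?M (indicator ?H)) A"
      using emeasure_K_reflN_le[OF t x, of "?H \<inter> A"] A by auto
  qed
  have dens: "(\<integral>\<^sup>+z. ennreal (h z) \<partial>density L (indicator ?H)) = (\<integral>\<^sup>+z. ennreal (h z) \<partial>L)"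
    if "sets L = sets borel" for L
    using that by (subst nn_integral_density)
      (auto simp: h_def indicator_def cong: measurable_cong_sets intro!: nn_integral_cong)
  have "(\<integral>\<^sup>+z. ennreal (h z) \<partial>?N) \<le> (\<integral>\<^sup>+z. ennreal (h z) \<partial>?M)"
    using nn_integral_mono_measure[OF _ le, of "\<lambda>z. ennreal (h z)"] by (simp add: dens)
  then have "(\<integral>\<^sup>+y. ennreal (h (reflN k (x - y))) \<partial>K t) \<le> (\<integral>\<^sup>+y. ennreal (h (x - y)) \<partial>K t)"
    by (subst (asm) (1 2) nn_integral_distr) auto
  moreover have "(\<integral>\<^sup>+y. ennreal (h (g y)) \<partial>K t) = ennreal (\<integral>y. h (g y) \<partial>K t)"
    if "g \<in> borel_measurable borel" for g
    using that by (intro nn_integral_eq_integral i) (use h0 in auto)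
  ultimately have "(\<integral>y. h (reflN k (x - y)) \<partial>K t) \<le> (\<integral>y. h (x - y) \<partial>K t)"
    by (simp add: h0)
  moreover have "conv (K t) f x = (\<integral>y. h (x - y) - h (reflN k (x - y)) \<partial>K t)"
    unfolding conv_def h_def by (intro Bochner_Integration.integral_cong refl odd_eq odd)
  moreover have "\<dots> = (\<integral>y. h (x - y) \<partial>K t) - (\<integral>y. h (reflN k (x - y)) \<partial>K t)"
    by (intro Bochner_Integration.integral_diff i) auto
  ultimately show ?thesis by simp
qed

lemma conv_K_diff:
  fixes f g :: "real^'n \<Rightarrow> real"
  assumes "f \<in> borel_measurable borel" "\<And>x. \<bar>f x\<bar> \<le> B" "g \<in> borel_measurable borel" "\<And>x. \<bar>g x\<bar> \<le> B'"
  shows "conv (K t) (\<lambda>x. g x - f x) x = conv (K t) g x - conv (K t) f x"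
  unfolding conv_def
  by (rule Bochner_Integration.integral_diff[OF integrable_conv_K[OF assms(3,4)] integrable_conv_K[OF assms(1,2)]])

lemma conv_K_mono:
  fixes f g :: "real^'n \<Rightarrow> real"
  assumes f: "f \<in> borel_measurable borel" "\<And>x. \<bar>f x\<bar> \<le> B" "\<And>x. f (reflN k x) = - f x"
    and g: "g \<in> borel_measurable borel" "\<And>x. \<bar>g x\<bar> \<le> B'" "\<And>x. g (reflN k x) = - g x"
    and le: "\<And>x. x \<in> halfspace k \<Longrightarrow> f x \<le> g x" and x: "x \<in> halfspace k"
  shows "conv (K t) f x \<le> conv (K t) g x"
proof -
  have "0 \<le> conv (K t) (\<lambda>x. g x - f x) x"
  proof (rule conv_K_nonneg[where B="B' + B"])
    show "\<bar>g x - f x\<bar> \<le> B' + B" for x using f(2)[of x] g(2)[of x] by linarith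
  qed (use f g le x in auto)
  then show ?thesis by (simp add: conv_K_diff[OF f(1,2) g(1,2)])
qed

lemma conv_K_tendsto:
  fixes f :: "nat \<Rightarrow> real^'n \<Rightarrow> real"
  assumes [measurable]: "\<And>n. f n \<in> borel_measurable borel" and B: "\<And>n x. \<bar>f n x\<bar> \<le> B"
    and lim: "\<And>x. (\<lambda>n. f n x) \<longlonglongrightarrow> g x"
  shows "(\<lambda>n. conv (K t) (f n) x) \<longlonglongrightarrow> conv (K t) g x"
  unfolding conv_def
proof (rule integral_dominated_convergence[where w="\<lambda>_. B"])
  interpret K: prob_space "K t" by (rule prob_space_K)
  show "integrable (K t) (\<lambda>_. B)" by simp
  have [measurable]: "g \<in> borel_measurable borel"
    by (rule borel_measurable_LIMSEQ_metric[OF assms(1) lim])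
  show "(\<lambda>y. g (x - y)) \<in> borel_measurable (K t)" by measurable
qed (use B lim in auto)

end

section \<open>Monotone iteration below a supersolution\<close>

lemma nl_minus [simp]: "nl \<alpha> (- v) = - nl \<alpha> v"
  by (simp add: nl_def)

lemma nl_0 [simp]: "nl \<alpha> 0 = 0"
  by (simp add: nl_def)

lemma abs_nl: "\<bar>nl \<alpha> v\<bar> = \<bar>v\<bar> powr \<alpha> * \<bar>v\<bar>"
  by (simp add: nl_def abs_mult)

lemma nl_nonneg: "0 \<le> v \<Longrightarrow> 0 \<le> nl \<alpha> v"
  by (simp add: nl_def)

lemma nl_mono: "0 \<le> \<alpha> \<Longrightarrow> 0 \<le> v \<Longrightarrow> v \<le> w \<Longrightarrow> nl \<alpha> v \<le> nl \<alpha> w"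
  by (auto simp: nl_def intro!: mult_mono powr_mono2)

lemma abs_nl_le: "0 \<le> \<alpha> \<Longrightarrow> \<bar>v\<bar> \<le> B \<Longrightarrow> \<bar>nl \<alpha> v\<bar> \<le> B powr \<alpha> * B"
  by (auto simp: abs_nl intro!: mult_mono powr_mono2)

lemma borel_measurable_nl [measurable]: "nl \<alpha> \<in> borel_measurable borel"
  unfolding nl_def[abs_def] by measurable

lemma isCont_nl: "0 < \<alpha> \<Longrightarrow> isCont (nl \<alpha>) v"
proof -
  assume "0 < \<alpha>"
  then have "continuous_on UNIV (nl \<alpha>)"
    unfolding nl_def[abs_def] by (intro continuous_on_mult continuous_on_powr' continuous_intros) auto
  then show ?thesis by (simp add: continuous_on_eq_continuous_at)
qed

lemma odd_abs_le:
  fixes f :: "real^'n::finite \<Rightarrow> real"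
  assumes odd: "\<And>x. f (reflN k x) = - f x" and le: "\<And>x. x \<in> halfspace k \<Longrightarrow> \<bar>f x\<bar> \<le> c" and c: "0 \<le> c"
  shows "\<bar>f x\<bar> \<le> c"
proof (cases "x $ k" "0::real" rule: linorder_cases)
  case less
  then show ?thesis using le[OF reflN_in_halfspace[OF less]] odd[of x] by simp
next
  case equal
  then show ?thesis using odd[of x] reflN_eq_self[OF equal] c by simp
next
  case greater
  then show ?thesis using le by (simp add: halfspace_def)
qed

text \<open>\<open>V\<close> stands for the linear flow and \<open>b\<close> for an envelope of its
  supremum norm. Most assumptions are made for all real times, so that measurability and the bounds
  require no case distinction on the sign of \<open>t\<close>; instances therefore freeze
  \<open>V\<close> and \<open>b\<close> at negative times.\<close>

locale duhamel_supersolution = half_space_kernel k G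
  for k :: "'n::finite" and G :: "real \<Rightarrow> (real^'n) measure" +
  fixes V :: "real \<Rightarrow> real^'n \<Rightarrow> real" and b :: "real \<Rightarrow> real" and \<alpha> B0 :: real
  assumes \<alpha>: "0 < \<alpha>"
    and V_measurable [measurable]: "(\<lambda>p. V (fst p) (snd p)) \<in> borel_measurable borel"
    and V_odd: "\<And>t x. V t (reflN k x) = - V t x"
    and V_nonneg: "\<And>t x. x \<in> halfspace k \<Longrightarrow> 0 \<le> V t x"
    and V_le: "\<And>t x. \<bar>V t x\<bar> \<le> b t"
    and b_le: "\<And>t. b t \<le> B0"
    and V_semigroup: "\<And>s t x. 0 \<le> s \<Longrightarrow> s \<le> t \<Longrightarrow> conv (K (t - s)) (V s) x = V t x"
    and b_integrable: "\<And>t. set_integrable lborel {0..t} (\<lambda>s. b s powr \<alpha>)"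
    and b_small: "\<And>t. 2 powr (1 + \<alpha>) * (LINT s : {0..t} | lborel. b s powr \<alpha>) \<le> 1"
begin

lemma b_nonneg: "0 \<le> b t"
  using V_le[of t 0] by linarith

lemma V_slice [measurable]: "V t \<in> borel_measurable borel"
  using measurable_compose[OF _ V_measurable, of "\<lambda>x. (t, x)" borel] by simp

text \<open>\<open>V t\<close> replaces the convolution of \<open>G t\<close> with the datum, and
  \<open>K\<close> replaces \<open>G\<close>: both are defined everywhere, which makes the fixed
  point equation pointwise.\<close>

definition duhamel :: "(real \<Rightarrow> real^'n \<Rightarrow> real) \<Rightarrow> real \<Rightarrow> real^'n \<Rightarrow> real" where
  "duhamel u t x = V t x + (LINT s : {0..t} | lborel. conv (K (t - s)) (\<lambda>z. nl \<alpha> (u s z)) x)"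

text \<open>The order interval between 0 and the supersolution, inside the odd functions. Its
  inequalities hold at every point, so they survive iteration without any bookkeeping of null
  sets.\<close>

definition admissible :: "(real \<Rightarrow> real^'n \<Rightarrow> real) \<Rightarrow> bool" where
  "admissible u \<longleftrightarrow> (\<lambda>p. u (fst p) (snd p)) \<in> borel_measurable borel \<and>
     (\<forall>t x. u t (reflN k x) = - u t x) \<and>
     (\<forall>t. \<forall>x\<in>halfspace k. 0 \<le> u t x \<and> u t x \<le> 2 * V t x)"

lemma admissibleD:
  assumes "admissible u"
  shows "(\<lambda>p. u (fst p) (snd p)) \<in> borel_measurable borel" "u t (reflN k x) = - u t x"
    "x \<in> halfspace k \<Longrightarrow> 0 \<le> u t x" "x \<in> halfspace k \<Longrightarrow> u t x \<le> 2 * V t x"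
  using assms by (auto simp: admissible_def)

lemma admissible_slice: "admissible u \<Longrightarrow> u t \<in> borel_measurable borel"
  using measurable_compose[OF _ admissibleD(1), of "\<lambda>x. (t, x)" borel u] by simp

lemma admissible_abs_le:
  assumes "admissible u"
  shows "\<bar>u t x\<bar> \<le> 2 * b t"
proof (rule odd_abs_le[where f="u t" and k=k])
  show "u t (reflN k x) = - u t x" for x using assms by (rule admissibleD)
  show "\<bar>u t x\<bar> \<le> 2 * b t" if "x \<in> halfspace k" for x
    using admissibleD(3,4)[OF assms that, of t] V_le[of t x] by linarith
qed (simp add: b_nonneg)

lemma admissible_nl_le: "admissible u \<Longrightarrow> \<bar>nl \<alpha> (u t x)\<bar> \<le> (2 * B0) powr \<alpha> * (2 * B0)"
  using admissible_abs_le[of u t x] b_le[of t] \<alpha> by (intro abs_nl_le) auto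

text \<open>The variable \<open>s\<close> enters through the kernel and through the source; joint
  measurability with \<open>(t, x)\<close> is what makes the Duhamel integral measurable in
  \<open>(t, x)\<close>.\<close>

lemma source_measurable:
  assumes "admissible u"
  shows "(\<lambda>(p, s). conv (K (fst p - s)) (\<lambda>z. nl \<alpha> (u s z)) (snd p)) \<in> borel_measurable ((borel \<Otimes>\<^sub>M borel) \<Otimes>\<^sub>M borel)"
proof -
  have um: "(\<lambda>p. u (fst p) (snd p)) \<in> borel_measurable (borel \<Otimes>\<^sub>M borel)"
    using admissibleD(1)[OF assms] by (simp add: borel_prod)
  have "(\<lambda>w. conv (K (fst (fst w) - snd w)) ((\<lambda>w z. nl \<alpha> (u (snd w) z)) w) (snd (fst w)))
      \<in> borel_measurable ((borel \<Otimes>\<^sub>M (borel :: (real^'n) measure)) \<Otimes>\<^sub>M borel)"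
  proof (rule borel_measurable_conv_K)
    have [measurable]: "(\<lambda>(w, z). u (snd w) z) \<in> borel_measurable (((borel \<Otimes>\<^sub>M (borel :: (real^'n) measure)) \<Otimes>\<^sub>M borel) \<Otimes>\<^sub>M borel)"
    proof -
      have "(\<lambda>q. (snd (fst q), snd q)) \<in> ((borel \<Otimes>\<^sub>M (borel :: (real^'n) measure)) \<Otimes>\<^sub>M borel) \<Otimes>\<^sub>M borel \<rightarrow>\<^sub>M borel \<Otimes>\<^sub>M borel"
        by measurable
      from measurable_compose[OF this um] show ?thesis by (simp add: split_beta')
    qed
    show "(\<lambda>(w, z). nl \<alpha> (u (snd w) z)) \<in> borel_measurable (((borel \<Otimes>\<^sub>M (borel :: (real^'n) measure)) \<Otimes>\<^sub>M borel) \<Otimes>\<^sub>M borel)"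
      by measurable
  qed measurable
  then show ?thesis by (simp add: split_beta')
qed

lemma source_integrable:
  assumes "admissible u"
  shows "set_integrable lborel {0..t} (\<lambda>s. conv (K (t - s)) (\<lambda>z. nl \<alpha> (u s z)) x)"
  unfolding set_integrable_def
proof (rule Bochner_Integration.integrable_bound)
  let ?M = "(2 * B0) powr \<alpha> * (2 * B0)"
  show "integrable lborel (\<lambda>s. indicator {0..t} s * ?M)"
    by (intro integrable_mult_left integrable_real_indicator) (auto simp: emeasure_lborel_Icc_eq)
  have "(\<lambda>s. conv (K (t - s)) (\<lambda>z. nl \<alpha> (u s z)) x) \<in> borel_measurable borel"
    using measurable_compose[OF _ source_measurable[OF assms], of "\<lambda>s. ((t, x), s)" borel] by simp
  then show "(\<lambda>s. indicator {0..t} s *\<^sub>R conv (K (t - s)) (\<lambda>z. nl \<alpha> (u s z)) x) \<in> borel_measurable lborel"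
    by simp
  have "\<bar>conv (K (t - s)) (\<lambda>z. nl \<alpha> (u s z)) x\<bar> \<le> ?M" for s
    by (intro conv_K_bound admissible_nl_le assms) (use admissible_slice[OF assms, measurable] in measurable)
  then show "AE s in lborel. norm (indicator {0..t} s *\<^sub>R conv (K (t - s)) (\<lambda>z. nl \<alpha> (u s z)) x) \<le> norm (indicator {0..t} s * ?M)"
    by (intro AE_I2) (auto simp: indicator_def intro: order_trans[OF _ abs_ge_self])
qed

lemma duhamel_measurable:
  assumes "admissible u"
  shows "(\<lambda>p. duhamel u (fst p) (snd p)) \<in> borel_measurable borel"
proof -
  note [measurable] = source_measurable[OF assms]
  have "(\<lambda>p. \<integral>s. indicator {0..fst p} s *\<^sub>R conv (K (fst p - s)) (\<lambda>z. nl \<alpha> (u s z)) (snd p) \<partial>lborel)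
      \<in> borel_measurable (borel \<Otimes>\<^sub>M borel)"
  proof (rule lborel.borel_measurable_lebesgue_integral)
    have "(\<lambda>q. if 0 \<le> snd q \<and> snd q \<le> fst (fst q) then (\<lambda>(p, s). conv (K (fst p - s)) (\<lambda>z. nl \<alpha> (u s z)) (snd p)) q else 0)
        \<in> borel_measurable ((borel \<Otimes>\<^sub>M borel) \<Otimes>\<^sub>M lborel)"
      by measurable
    then show "(\<lambda>(p, s). indicator {0..fst p} s *\<^sub>R conv (K (fst p - s)) (\<lambda>z. nl \<alpha> (u s z)) (snd p))
        \<in> borel_measurable ((borel \<Otimes>\<^sub>M borel) \<Otimes>\<^sub>M lborel)"
      by (rule measurable_cong[THEN iffD1, rotated]) (auto simp: indicator_def split_beta')
  qed
  then show ?thesis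
    unfolding duhamel_def set_lebesgue_integral_def by (intro borel_measurable_add V_measurable) (simp add: borel_prod)
qed

lemma nl_slice:
  assumes "admissible u"
  shows "(\<lambda>z. nl \<alpha> (u s z)) \<in> borel_measurable borel" "nl \<alpha> (u s (reflN k z)) = - nl \<alpha> (u s z)"
  using admissible_slice[OF assms, measurable] admissibleD(2)[OF assms] by simp_all

text \<open>\<open>nl\<close> is odd and increasing on nonnegative values, so the sources are odd
  and ordered on the half space, and the kernel preserves that order.\<close>

lemma duhamel_mono:
  assumes u: "admissible u" and w: "admissible w" and le: "\<And>t x. x \<in> halfspace k \<Longrightarrow> u t x \<le> w t x"
    and x: "x \<in> halfspace k"
  shows "duhamel u t x \<le> duhamel w t x"
proof -
  have "conv (K (t - s)) (\<lambda>z. nl \<alpha> (u s z)) x \<le> conv (K (t - s)) (\<lambda>z. nl \<alpha> (w s z)) x" for s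
    using \<alpha> admissibleD(3)[OF u]
    by (intro conv_K_mono[OF nl_slice(1)[OF u] admissible_nl_le[OF u] nl_slice(2)[OF u]
          nl_slice(1)[OF w] admissible_nl_le[OF w] nl_slice(2)[OF w] _ x] nl_mono le) auto
  then show ?thesis
    unfolding duhamel_def by (intro add_left_mono set_integral_mono source_integrable u w)
qed

text \<open>The supersolution estimate: the source of \<open>2 * V s\<close> is
  \<open>2 powr (1 + \<alpha>)\<close> times \<open>V s powr \<alpha> * V s\<close>. The first power
  is bounded by the constant \<open>b s powr \<alpha>\<close>; the remaining factor
  \<open>V s\<close> is carried to \<open>V t\<close> by the semigroup law. What is left is a scalar
  integral, at most 1 by \<open>b_small\<close>.\<close>

lemma admissible_duhamel:
  assumes u: "admissible u"
  shows "admissible (duhamel u)"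
  unfolding admissible_def
proof (intro conjI allI ballI)
  show "(\<lambda>p. duhamel u (fst p) (snd p)) \<in> borel_measurable borel"
    using u by (rule duhamel_measurable)
  show "duhamel u t (reflN k x) = - duhamel u t x" for t x
    using conv_K_odd[OF nl_slice[OF u]] by (simp add: duhamel_def V_odd set_lebesgue_integral_def)
  fix t x assume x: "x \<in> halfspace k"
  have "0 \<le> conv (K (t - s)) (\<lambda>z. nl \<alpha> (u s z)) x" for s
    using admissibleD(3)[OF u]
    by (intro conv_K_nonneg[OF nl_slice(1)[OF u] admissible_nl_le[OF u] nl_slice(2)[OF u] _ x] nl_nonneg)
  then show "0 \<le> duhamel u t x"
    unfolding duhamel_def using V_nonneg[OF x, of t]
    by (intro add_nonneg_nonneg) (auto simp: set_lebesgue_integral_def intro!: Bochner_Integration.integral_nonneg)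
  have le: "conv (K (t - s)) (\<lambda>z. nl \<alpha> (u s z)) x \<le> (2 powr (1 + \<alpha>) * b s powr \<alpha>) * V t x"
    if s: "s \<in> {0..t}" for s
  proof -
    let ?c = "2 powr (1 + \<alpha>) * b s powr \<alpha>"
    have "nl \<alpha> (u s z) \<le> ?c * V s z" if z: "z \<in> halfspace k" for z
    proof -
      have "nl \<alpha> (u s z) \<le> nl \<alpha> (2 * V s z)"
        using admissibleD(3,4)[OF u z] \<alpha> by (intro nl_mono) auto
      also have "\<dots> = (2 powr (1 + \<alpha>) * V s z powr \<alpha>) * V s z"
        using V_nonneg[OF z, of s] by (simp add: nl_def powr_mult powr_add abs_mult)
      also have "\<dots> \<le> ?c * V s z"
        using V_nonneg[OF z, of s] V_le[of s z] \<alpha>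
        by (intro mult_right_mono mult_left_mono powr_mono2) auto
      finally show ?thesis .
    qed
    then have "conv (K (t - s)) (\<lambda>z. nl \<alpha> (u s z)) x \<le> conv (K (t - s)) (\<lambda>z. ?c * V s z) x"
      by (intro conv_K_mono[OF nl_slice(1)[OF u] admissible_nl_le[OF u] nl_slice(2)[OF u] _ _ _ _ x, where B'="?c * b s"])
         (use V_le[of s] in \<open>auto simp: V_odd abs_mult intro!: mult_left_mono\<close>)
    also have "\<dots> = ?c * conv (K (t - s)) (V s) x" by (simp add: conv_def)
    also have "conv (K (t - s)) (V s) x = V t x" using s by (intro V_semigroup) auto
    finally show ?thesis .
  qed
  have "(LINT s : {0..t} | lborel. conv (K (t - s)) (\<lambda>z. nl \<alpha> (u s z)) x)
      \<le> (LINT s : {0..t} | lborel. (2 powr (1 + \<alpha>) * b s powr \<alpha>) * V t x)"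
    by (intro set_integral_mono source_integrable u le set_integrable_mult_left set_integrable_mult_right b_integrable)
  also have "\<dots> = (2 powr (1 + \<alpha>) * (LINT s : {0..t} | lborel. b s powr \<alpha>)) * V t x"
    by simp
  also have "\<dots> \<le> 1 * V t x"
    by (intro mult_right_mono b_small V_nonneg x)
  finally show "duhamel u t x \<le> 2 * V t x" by (simp add: duhamel_def)
qed

definition iter :: "nat \<Rightarrow> real \<Rightarrow> real^'n \<Rightarrow> real" where
  "iter n = (duhamel ^^ n) (\<lambda>_ _. 0)"

lemma iter_Suc: "iter (Suc n) = duhamel (iter n)"
  by (simp add: iter_def)

lemma admissible_iter: "admissible (iter n)"
proof (induction n)
  case 0
  then show ?case using V_nonneg by (auto simp: iter_def admissible_def)
next
  case (Suc n)
  then show ?case unfolding iter_Suc by (rule admissible_duhamel)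
qed

lemma iter_le_Suc: "x \<in> halfspace k \<Longrightarrow> iter n t x \<le> iter (Suc n) t x"
proof (induction n arbitrary: t x)
  case 0
  then show ?case using admissibleD(3)[OF admissible_iter, of x "Suc 0" t] by (simp add: iter_def)
next
  case (Suc n)
  have "duhamel (iter n) t x \<le> duhamel (iter (Suc n)) t x"
    by (rule duhamel_mono[OF admissible_iter admissible_iter Suc.IH Suc.prems])
  then show ?case by (simp only: iter_Suc)
qed

text \<open>Monotonicity is available only on the half space; oddness transfers convergence to the
  other side, and on the hyperplane all iterates vanish.\<close>

lemma iter_convergent: "convergent (\<lambda>n. iter n t x)"
proof -
  have *: "convergent (\<lambda>n. iter n t x)" if x: "x \<in> halfspace k" for x
  proof -
    have "incseq (\<lambda>n. iter n t x)" using iter_le_Suc[OF x] by (intro incseq_SucI)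
    moreover have "iter n t x \<le> 2 * V t x" for n using admissibleD(4)[OF admissible_iter x] .
    ultimately obtain L where "(\<lambda>n. iter n t x) \<longlonglongrightarrow> L"
      using incseq_convergent[of "\<lambda>n. iter n t x" "2 * V t x"] by blast
    then show ?thesis by (rule convergentI)
  qed
  show ?thesis
  proof (cases "x $ k" "0::real" rule: linorder_cases)
    case less
    then have "convergent (\<lambda>n. iter n t (reflN k x))" by (intro * reflN_in_halfspace)
    then show ?thesis by (simp add: admissibleD(2)[OF admissible_iter] convergent_minus_iff[symmetric])
  next
    case equal
    then have "iter n t x = 0" for n
      using admissibleD(2)[OF admissible_iter, of n t x] reflN_eq_self[OF equal] by simp
    then show ?thesis by (simp add: convergent_const)
  next
    case greater
    then show ?thesis by (intro *) (simp add: halfspace_def)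
  qed
qed

definition sol :: "real \<Rightarrow> real^'n \<Rightarrow> real" where
  "sol t x = lim (\<lambda>n. iter n t x)"

lemma iter_tendsto: "(\<lambda>n. iter n t x) \<longlonglongrightarrow> sol t x"
  using iter_convergent by (simp add: sol_def convergent_LIMSEQ_iff)

lemma admissible_sol: "admissible sol"
  unfolding admissible_def
proof (intro conjI allI ballI)
  show "(\<lambda>p. sol (fst p) (snd p)) \<in> borel_measurable borel"
    by (rule borel_measurable_LIMSEQ_metric[OF admissibleD(1)[OF admissible_iter] iter_tendsto])
  fix t x
  have "(\<lambda>n. - iter n t x) \<longlonglongrightarrow> sol t (reflN k x)"
    using iter_tendsto[of t "reflN k x"] by (simp add: admissibleD(2)[OF admissible_iter])
  then show "sol t (reflN k x) = - sol t x"
    using tendsto_minus[OF iter_tendsto[of t x]] by (rule LIMSEQ_unique)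
next
  fix t x assume x: "x \<in> halfspace k"
  show "0 \<le> sol t x" by (rule LIMSEQ_le_const[OF iter_tendsto]) (use admissibleD(3)[OF admissible_iter x] in auto)
  show "sol t x \<le> 2 * V t x" by (rule LIMSEQ_le_const2[OF iter_tendsto]) (use admissibleD(4)[OF admissible_iter x] in auto)
qed

text \<open>Dominated convergence twice, against the kernel in space and then over
  \<open>{0..t}\<close> in time, with the same constant bound on all sources.\<close>

theorem sol_duhamel: "sol t x = duhamel sol t x"
proof -
  let ?M = "(2 * B0) powr \<alpha> * (2 * B0)"
  have "(\<lambda>n. conv (K (t - s)) (\<lambda>z. nl \<alpha> (iter n s z)) x) \<longlonglongrightarrow> conv (K (t - s)) (\<lambda>z. nl \<alpha> (sol s z)) x" for s
    by (intro conv_K_tendsto[OF nl_slice(1) admissible_nl_le] admissible_iter isCont_tendsto_compose[OF isCont_nl] iter_tendsto \<alpha>)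
  moreover have "\<bar>conv (K (t - s)) (\<lambda>z. nl \<alpha> (iter n s z)) x\<bar> \<le> ?M" for s n
    by (intro conv_K_bound nl_slice admissible_nl_le admissible_iter)
  ultimately have "(\<lambda>n. LINT s : {0..t} | lborel. conv (K (t - s)) (\<lambda>z. nl \<alpha> (iter n s z)) x)
      \<longlonglongrightarrow> (LINT s : {0..t} | lborel. conv (K (t - s)) (\<lambda>z. nl \<alpha> (sol s z)) x)"
    unfolding set_lebesgue_integral_def
  proof (intro integral_dominated_convergence[where w="\<lambda>s. indicator {0..t} s * ?M"])
    assume lim: "\<And>s. (\<lambda>n. conv (K (t - s)) (\<lambda>z. nl \<alpha> (iter n s z)) x) \<longlonglongrightarrow> conv (K (t - s)) (\<lambda>z. nl \<alpha> (sol s z)) x"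
      and le: "\<And>s n. \<bar>conv (K (t - s)) (\<lambda>z. nl \<alpha> (iter n s z)) x\<bar> \<le> ?M"
    show "(\<lambda>s. indicator {0..t} s *\<^sub>R conv (K (t - s)) (\<lambda>z. nl \<alpha> (sol s z)) x) \<in> borel_measurable lborel"
      using source_integrable[OF admissible_sol] unfolding set_integrable_def by (rule borel_measurable_integrable)
    show "(\<lambda>s. indicator {0..t} s *\<^sub>R conv (K (t - s)) (\<lambda>z. nl \<alpha> (iter n s z)) x) \<in> borel_measurable lborel" for n
      using source_integrable[OF admissible_iter] unfolding set_integrable_def by (rule borel_measurable_integrable)
    show "integrable lborel (\<lambda>s. indicator {0..t} s * ?M)"
      by (intro integrable_mult_left integrable_real_indicator) (auto simp: emeasure_lborel_Icc_eq)
    show "AE s in lborel. (\<lambda>n. indicator {0..t} s *\<^sub>R conv (K (t - s)) (\<lambda>z. nl \<alpha> (iter n s z)) x)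
        \<longlonglongrightarrow> indicator {0..t} s *\<^sub>R conv (K (t - s)) (\<lambda>z. nl \<alpha> (sol s z)) x"
      by (intro AE_I2 tendsto_scaleR tendsto_const lim)
    show "AE s in lborel. norm (indicator {0..t} s *\<^sub>R conv (K (t - s)) (\<lambda>z. nl \<alpha> (iter n s z)) x) \<le> indicator {0..t} s * ?M" for n
      using le by (intro AE_I2) (auto simp: indicator_def)
  qed
  then have "(\<lambda>n. iter (Suc n) t x) \<longlonglongrightarrow> duhamel sol t x"
    unfolding iter_Suc duhamel_def by (intro tendsto_add tendsto_const)
  then show ?thesis using LIMSEQ_Suc[OF iter_tendsto] by (intro LIMSEQ_unique)
qed

end

section \<open>Decay of the linear flow\<close>

lemma powr_mult_exp_bounded:
  fixes \<delta> q :: real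
  assumes "0 < \<delta>"
  obtains C where "0 < C" "\<And>y. 1 \<le> y \<Longrightarrow> y powr q * exp (- (\<delta> * y)) \<le> C"
proof -
  obtain m :: nat where m: "q \<le> real m" using real_arch_simple by blast
  have "y powr q * exp (- (\<delta> * y)) \<le> fact m / \<delta> ^ m" if y: "1 \<le> y" for y :: real
  proof -
    have "y powr q \<le> y ^ m"
      using y m by (simp add: powr_mono flip: powr_realpow)
    \<comment> \<open>A single term of the exponential series already beats the power.\<close>
    moreover have "(\<delta> * y) ^ m / fact m \<le> exp (\<delta> * y)"
    proof -
      have "(\<Sum>n\<in>{m}. (\<delta> * y) ^ n /\<^sub>R fact n) \<le> (\<Sum>n. (\<delta> * y) ^ n /\<^sub>R fact n)"
        using assms y by (intro sum_le_suminf summable_exp_generic) auto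
      then show ?thesis by (simp add: exp_def field_simps)
    qed
    ultimately have "y powr q * exp (- (\<delta> * y)) \<le> y ^ m * (fact m / (\<delta> * y) ^ m)"
      using assms y
      by (intro mult_mono) (auto simp: exp_minus field_simps)
    also have "\<dots> = fact m / \<delta> ^ m" using y by (simp add: power_mult_distrib)
    finally show ?thesis .
  qed
  moreover have "0 < fact m / \<delta> ^ m" using assms by simp
  ultimately show ?thesis using that by blast
qed

lemma integrable_prod_inverse_1_plus_square:
  "integrable lborel (\<lambda>x::'a::euclidean_space. \<Prod>b\<in>Basis. inverse (1 + (x \<bullet> b)\<^sup>2))"
proof (rule integrable_lborel_prod[where f="\<lambda>_ x. inverse (1 + x\<^sup>2)"])
  show "integrable lborel (\<lambda>x::real. inverse (1 + x\<^sup>2))"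
    using integrable_inverse_1_plus_square by (simp add: set_integrable_def einterval_def)
qed

text \<open>The majorant is a product of one-dimensional functions
  \<open>inverse (1 + x\<^sup>2)\<close>, whose integrability is immediate in Cartesian coordinates;
  any power of the norm is absorbed by the exponential.\<close>

lemma nn_integral_norm_exp_powr_finite:
  assumes c: "0 < c" and \<beta>: "0 < \<beta>"
  shows "(\<integral>\<^sup>+\<xi>. ennreal (norm \<xi> * exp (- (c * norm \<xi> powr \<beta>))) \<partial>(lborel :: 'a::euclidean_space measure)) < \<infinity>"
proof -
  let ?N = "DIM('a)"
  \<comment> \<open>Used at \<open>y = norm \<xi> powr \<beta>\<close>: the denominators contribute
    the power \<open>2 * ?N\<close> of the norm, the weight contributes one more.\<close>
  obtain C where C: "0 < C" "\<And>y. 1 \<le> y \<Longrightarrow> y powr ((2 * ?N + 1) / \<beta>) * exp (- (c * y)) \<le> C"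
    using powr_mult_exp_bounded[OF c] by blast
  define D where "D = 2 ^ ?N * max 1 C"
  have D: "norm \<xi> * exp (- (c * norm \<xi> powr \<beta>)) \<le> D * (\<Prod>b\<in>Basis. inverse (1 + (\<xi> \<bullet> b)\<^sup>2))" for \<xi> :: 'a
  proof -
    let ?r = "norm \<xi>"
    have P: "(\<Prod>b\<in>Basis. 1 + (\<xi> \<bullet> b)\<^sup>2) \<le> (1 + ?r\<^sup>2) ^ ?N"
    proof -
      have "(\<Prod>b\<in>Basis. 1 + (\<xi> \<bullet> b)\<^sup>2) \<le> (\<Prod>b\<in>(Basis::'a set). 1 + ?r\<^sup>2)"
        by (intro prod_mono conjI add_left_mono abs_le_square_iff[THEN iffD1]) (auto simp: Basis_le_norm)
      then show ?thesis by simp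
    qed
    have P0: "0 < (\<Prod>b\<in>Basis. 1 + (\<xi> \<bullet> b)\<^sup>2)" by (intro prod_pos) (auto intro: add_pos_nonneg)
    have "?r * exp (- (c * ?r powr \<beta>)) * (1 + ?r\<^sup>2) ^ ?N \<le> D"
    proof (cases "1 \<le> ?r")
      case True
      have "(1 + ?r\<^sup>2) ^ ?N \<le> (2 * ?r\<^sup>2) ^ ?N"
        using True by (intro power_mono) (auto simp: one_le_power)
      then have "?r * exp (- (c * ?r powr \<beta>)) * (1 + ?r\<^sup>2) ^ ?N \<le> ?r * exp (- (c * ?r powr \<beta>)) * (2 * ?r\<^sup>2) ^ ?N"
        by (intro mult_left_mono) auto
      also have "\<dots> = 2 ^ ?N * (?r ^ (2 * ?N + 1) * exp (- (c * ?r powr \<beta>)))"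
        by (simp add: power_mult_distrib power_mult)
      also have "?r ^ (2 * ?N + 1) = ?r powr real (2 * ?N + 1)"
        by (rule powr_realpow[symmetric]) (use True in linarith)
      also have "\<dots> = (?r powr \<beta>) powr ((2 * ?N + 1) / \<beta>)"
        using \<beta> by (simp add: powr_powr)
      also have "2 ^ ?N * ((?r powr \<beta>) powr ((2 * ?N + 1) / \<beta>) * exp (- (c * ?r powr \<beta>))) \<le> 2 ^ ?N * C"
        using True \<beta> by (intro mult_left_mono C) (auto simp: ge_one_powr_ge_zero)
      also have "\<dots> \<le> D" by (simp add: D_def)
      finally show ?thesis .
    next
      case False
      then have "?r * exp (- (c * ?r powr \<beta>)) * (1 + ?r\<^sup>2) ^ ?N \<le> (1 * 1) * 2 ^ ?N"
        using c by (intro mult_mono power_mono) (auto simp: power_le_one)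
      also have "\<dots> \<le> D" by (simp add: D_def)
      finally show ?thesis .
    qed
    then have "?r * exp (- (c * ?r powr \<beta>)) * (\<Prod>b\<in>Basis. 1 + (\<xi> \<bullet> b)\<^sup>2) \<le> D"
      by (rule order_trans[rotated]) (intro mult_left_mono P, auto)
    moreover have "(\<Prod>b\<in>Basis. inverse (1 + (\<xi> \<bullet> b)\<^sup>2)) = inverse (\<Prod>b\<in>Basis. 1 + (\<xi> \<bullet> b)\<^sup>2)"
      using prod_inversef[of "\<lambda>b. 1 + (\<xi> \<bullet> b)\<^sup>2" Basis] by (simp add: comp_def)
    ultimately show ?thesis using P0 by (simp only: divide_inverse[symmetric] pos_le_divide_eq)
  qed
  have "(\<integral>\<^sup>+\<xi>. ennreal (norm \<xi> * exp (- (c * norm \<xi> powr \<beta>))) \<partial>(lborel :: 'a measure))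
      \<le> (\<integral>\<^sup>+\<xi>. ennreal (norm (D * (\<Prod>b\<in>Basis. inverse (1 + (\<xi> \<bullet> b)\<^sup>2)))) \<partial>(lborel :: 'a measure))"
    by (intro nn_integral_mono ennreal_leI order_trans[OF D]) simp
  also have "\<dots> < \<infinity>"
    using integrable_mult_right[OF integrable_prod_inverse_1_plus_square, of D]
    unfolding integrable_iff_bounded by blast
  finally show ?thesis .
qed

text \<open>Rescaling by \<open>T powr (- 1 / \<beta>)\<close> makes the exponent independent of
  \<open>T\<close>. The Jacobian gives N such factors and the weight \<open>norm \<xi>\<close> one
  more: this is the origin of the decay rate.\<close>

lemma nn_integral_norm_exp_powr_scale:
  assumes T: "0 < T" and \<beta>: "0 < \<beta>"
  shows "(\<integral>\<^sup>+\<xi>. ennreal (norm \<xi> * exp (- (c * T * norm \<xi> powr \<beta>))) \<partial>(lborel :: 'a::euclidean_space measure))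
       = ennreal (T powr (- ((real DIM('a) + 1) / \<beta>))) * (\<integral>\<^sup>+\<xi>. ennreal (norm \<xi> * exp (- (c * norm \<xi> powr \<beta>))) \<partial>(lborel :: 'a measure))"
proof -
  let ?e = "T powr (- 1 / \<beta>)"
  have e: "0 < ?e" using T by simp
  have ee: "?e ^ DIM('a) * ?e = T powr (- ((real DIM('a) + 1) / \<beta>))"
    using T by (simp add: powr_realpow[symmetric] powr_powr powr_add[symmetric] add_divide_distrib algebra_simps diff_divide_distrib)
  have Te: "T * norm (?e *\<^sub>R \<xi>) powr \<beta> = norm \<xi> powr \<beta>" for \<xi> :: 'a
  proof -
    have "?e powr \<beta> = 1 / T" using T \<beta> by (simp only: powr_powr) (simp add: powr_minus_divide)
    then show ?thesis using T by (simp add: powr_mult)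
  qed
  have fe: "norm (0 + ?e *\<^sub>R \<xi>) * exp (- (c * T * norm (0 + ?e *\<^sub>R \<xi>) powr \<beta>)) = ?e * (norm \<xi> * exp (- (c * norm \<xi> powr \<beta>)))" for \<xi> :: 'a
  proof -
    have "c * T * norm (?e *\<^sub>R \<xi>) powr \<beta> = c * norm \<xi> powr \<beta>"
      using Te[of \<xi>] by (simp only: mult.assoc)
    then show ?thesis unfolding add_0_left using e by (simp only: norm_scaleR abs_of_pos mult.assoc)
  qed
  have "(\<integral>\<^sup>+\<xi>. ennreal (norm \<xi> * exp (- (c * T * norm \<xi> powr \<beta>))) \<partial>(lborel :: 'a measure))
      = ennreal (\<bar>?e\<bar> ^ DIM('a)) * (\<integral>\<^sup>+\<xi>. ennreal (norm (0 + ?e *\<^sub>R \<xi>) * exp (- (c * T * norm (0 + ?e *\<^sub>R \<xi>) powr \<beta>))) \<partial>(lborel :: 'a measure))"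
    by (rule lborel_nn_integral_affine) (use e in auto)
  also have "\<dots> = ennreal (?e ^ DIM('a)) * (\<integral>\<^sup>+\<xi>. ennreal ?e * ennreal (norm \<xi> * exp (- (c * norm \<xi> powr \<beta>))) \<partial>(lborel :: 'a measure))"
    using e by (simp only: fe abs_of_pos ennreal_mult less_imp_le norm_ge_zero exp_ge_zero mult_nonneg_nonneg)
  also have "\<dots> = ennreal (?e ^ DIM('a) * ?e) * (\<integral>\<^sup>+\<xi>. ennreal (norm \<xi> * exp (- (c * norm \<xi> powr \<beta>))) \<partial>(lborel :: 'a measure))"
    using e by (subst nn_integral_cmult) (auto simp: ennreal_mult mult.assoc)
  finally show ?thesis unfolding ee .
qed

section \<open>The Fourier transform of an odd extension near the origin\<close>

lemma norm_cis_diff_le: "norm (cis a - cis b) \<le> \<bar>a - b\<bar>"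
proof -
  \<comment> \<open>The chord has length twice the modulus of \<open>sin ((a - b) / 2)\<close>,
    hence is shorter than the arc.\<close>
  have "(norm (cis a - cis b))\<^sup>2 = 2 - 2 * cos (a - b)"
    unfolding cmod_power2 cos_diff
    using sin_cos_squared_add[of a] sin_cos_squared_add[of b] by (simp add: power2_eq_square algebra_simps)
  also have "\<dots> = 4 * (sin ((a - b) / 2))\<^sup>2"
    using cos_double_sin[of "(a - b) / 2"] by (simp only: mult_2 field_sum_of_halves)
  also have "\<dots> \<le> 4 * ((a - b) / 2)\<^sup>2"
    by (intro mult_left_mono abs_le_square_iff[THEN iffD1] abs_sin_x_le_abs_x) auto
  also have "\<dots> = \<bar>a - b\<bar>\<^sup>2" by (simp add: power_divide)
  finally show ?thesis by (rule power2_le_imp_le) simp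
qed

lemma integrable_lborel_reflN:
  fixes f :: "real^'n::finite \<Rightarrow> 'b::{banach, second_countable_topology}"
  assumes f: "integrable lborel f"
  shows "integrable lborel (\<lambda>x. f (reflN k x))" "(\<integral>x. f (reflN k x) \<partial>lborel) = (\<integral>x. f x \<partial>lborel)"
proof -
  have [measurable]: "f \<in> borel_measurable borel" using f by auto
  have "integrable (distr lborel borel (reflN k)) f" unfolding lborel_distr_reflN by (rule f)
  then show "integrable lborel (\<lambda>x. f (reflN k x))" by (subst (asm) integrable_distr_eq) auto
  have "(\<integral>x. f x \<partial>distr lborel borel (reflN k)) = (\<integral>x. f (reflN k x) \<partial>lborel)"
    by (rule integral_distr) auto
  then show "(\<integral>x. f (reflN k x) \<partial>lborel) = (\<integral>x. f x \<partial>lborel)" by (simp add: lborel_distr_reflN)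
qed

lemma integrable_oddext:
  fixes u :: "real^'n::finite \<Rightarrow> real"
  assumes "set_integrable lborel (halfspace k) u"
  shows "integrable lborel (oddext k u)"
proof -
  have g: "integrable lborel (\<lambda>x. indicator (halfspace k) x * u x)"
    using assms by (simp add: set_integrable_def)
  show ?thesis
    unfolding oddext_eq[abs_def]
    by (rule Bochner_Integration.integrable_diff[OF g integrable_lborel_reflN(1)[OF g]])
qed

text \<open>Folding the integral onto the half space produces \<open>sin (x\<^sub>k \<xi>\<^sub>k)\<close>, whence the first moment.\<close>
lemma norm_fourier_oddext_le:
  fixes u :: "real^'n::finite \<Rightarrow> real"
  assumes u: "set_integrable lborel (halfspace k) u" and xu: "set_integrable lborel (halfspace k) (\<lambda>x. x $ k * u x)"
    and pos: "AE x in lborel. x \<in> halfspace k \<longrightarrow> 0 \<le> u x"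
  shows "norm (fourier (oddext k u) \<xi>) \<le> 2 * m1 k u * norm \<xi>"
proof -
  define g where "g x = indicator (halfspace k) x * u x" for x
  have g: "integrable lborel g" using u by (simp add: set_integrable_def g_def[abs_def])
  then have [measurable]: "g \<in> borel_measurable borel" by auto
  have i: "integrable lborel (\<lambda>x. cis (h x) * complex_of_real (g x))" if [measurable]: "h \<in> borel_measurable borel" for h
    by (rule Bochner_Integration.integrable_bound[OF g]) (auto simp: norm_mult)
  have i1: "integrable lborel (\<lambda>x. cis (- (x \<bullet> \<xi>)) * complex_of_real (g x))"
    and i2: "integrable lborel (\<lambda>x. cis (- (reflN k x \<bullet> \<xi>)) * complex_of_real (g x))"
    by (rule i; measurable)+
  have "fourier (oddext k u) \<xi> = (\<integral>x. cis (- (x \<bullet> \<xi>)) * complex_of_real (g x) - cis (- (x \<bullet> \<xi>)) * complex_of_real (g (reflN k x)) \<partial>lborel)"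
    unfolding fourier_def oddext_eq g_def by (intro Bochner_Integration.integral_cong refl) (simp only: of_real_diff right_diff_distrib)
  also have "\<dots> = (\<integral>x. cis (- (x \<bullet> \<xi>)) * complex_of_real (g x) \<partial>lborel) - (\<integral>x. cis (- (x \<bullet> \<xi>)) * complex_of_real (g (reflN k x)) \<partial>lborel)"
    using integrable_lborel_reflN(1)[OF i2, of k] by (intro Bochner_Integration.integral_diff i1) simp
  also have "(\<integral>x. cis (- (x \<bullet> \<xi>)) * complex_of_real (g (reflN k x)) \<partial>lborel) = (\<integral>x. cis (- (reflN k x \<bullet> \<xi>)) * complex_of_real (g x) \<partial>lborel)"
    using integrable_lborel_reflN(2)[OF i2, of k] by simp
  also have "(\<integral>x. cis (- (x \<bullet> \<xi>)) * complex_of_real (g x) \<partial>lborel) - (\<integral>x. cis (- (reflN k x \<bullet> \<xi>)) * complex_of_real (g x) \<partial>lborel)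
      = (\<integral>x. (cis (- (x \<bullet> \<xi>)) - cis (- (reflN k x \<bullet> \<xi>))) * complex_of_real (g x) \<partial>lborel)"
    unfolding left_diff_distrib by (rule Bochner_Integration.integral_diff[OF i1 i2, symmetric])
  finally have eq: "fourier (oddext k u) \<xi> = (\<integral>x. (cis (- (x \<bullet> \<xi>)) - cis (- (reflN k x \<bullet> \<xi>))) * complex_of_real (g x) \<partial>lborel)" .
  have xg: "integrable lborel (\<lambda>x. x $ k * g x)"
    using xu by (simp add: set_integrable_def g_def mult_ac)
  have ig: "integrable lborel (\<lambda>x. (cis (- (x \<bullet> \<xi>)) - cis (- (reflN k x \<bullet> \<xi>))) * complex_of_real (g x))"
    unfolding left_diff_distrib by (rule Bochner_Integration.integrable_diff[OF i1 i2])
  have "norm (fourier (oddext k u) \<xi>) \<le> (\<integral>x. norm ((cis (- (x \<bullet> \<xi>)) - cis (- (reflN k x \<bullet> \<xi>))) * complex_of_real (g x)) \<partial>lborel)"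
    unfolding eq by (rule integral_norm_bound)
  also have "\<dots> \<le> (\<integral>x. (2 * norm \<xi>) * (x $ k * g x) \<partial>lborel)"
  proof (rule integral_mono_AE[OF integrable_norm[OF ig] integrable_mult_right[OF xg]])
    show "AE x in lborel. norm ((cis (- (x \<bullet> \<xi>)) - cis (- (reflN k x \<bullet> \<xi>))) * complex_of_real (g x)) \<le> (2 * norm \<xi>) * (x $ k * g x)"
      using pos
    proof eventually_elim
      case (elim x)
      show ?case
      proof (cases "x \<in> halfspace k")
        case True
        then have x: "0 < x $ k" and gx: "0 \<le> g x" using elim by (auto simp: halfspace_def g_def)
        have "norm (cis (- (x \<bullet> \<xi>)) - cis (- (reflN k x \<bullet> \<xi>))) \<le> \<bar>- (x \<bullet> \<xi>) - - (reflN k x \<bullet> \<xi>)\<bar>"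
          by (rule norm_cis_diff_le)
        also have "\<dots> = \<bar>(x - reflN k x) \<bullet> \<xi>\<bar>" by (simp add: inner_diff_left)
        also have "x - reflN k x = axis k (2 * x $ k)"
          by (simp add: vec_eq_iff axis_def)
        also have "\<bar>axis k (2 * x $ k) \<bullet> \<xi>\<bar> \<le> 2 * x $ k * norm \<xi>"
          using x component_le_norm_cart[of \<xi> k] by (simp add: inner_axis' abs_mult mult_left_mono)
        finally have "norm (cis (- (x \<bullet> \<xi>)) - cis (- (reflN k x \<bullet> \<xi>))) * g x \<le> 2 * x $ k * norm \<xi> * g x"
          using gx by (rule mult_right_mono)
        then show ?thesis using gx by (simp add: norm_mult mult_ac)
      qed (simp add: g_def)
    qed
  qed
  also have "\<dots> = 2 * norm \<xi> * (\<integral>x. x $ k * g x \<partial>lborel)"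
    by (rule integral_mult_right_zero)
  also have "(\<integral>x. x $ k * g x \<partial>lborel) = m1 k u"
    by (simp add: m1_def set_lebesgue_integral_def g_def mult_ac)
  finally show ?thesis by (simp add: mult_ac)
qed

text \<open>Half of \<open>a\<close> absorbs the little-o remainder near the origin; away from it
  the supremum condition gives a spectral gap.\<close>

lemma symbol_bounds:
  fixes J0 :: "real^'n::finite \<Rightarrow> real"
  assumes a: "0 < a"
    and J0_exp: "(\<lambda>\<xi>. J0 \<xi> - (1 - a * norm \<xi> powr \<beta>)) \<in> o[at 0](\<lambda>\<xi>. norm \<xi> powr \<beta>)"
    and J0_sup: "\<forall>r>0. \<exists>c<1. \<forall>\<xi>. r \<le> norm \<xi> \<longrightarrow> J0 \<xi> \<le> c"
    and le1: "\<And>\<xi>. J0 \<xi> \<le> 1"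
  obtains r \<delta> where "0 < r" "r \<le> 1" "0 < \<delta>"
    "\<And>\<xi>. norm \<xi> < r \<Longrightarrow> J0 \<xi> - 1 \<le> - (a / 2 * norm \<xi> powr \<beta>)"
    "\<And>\<xi>. r \<le> norm \<xi> \<Longrightarrow> J0 \<xi> - 1 \<le> - \<delta>"
proof -
  have "eventually (\<lambda>\<xi>. norm (J0 \<xi> - (1 - a * norm \<xi> powr \<beta>)) \<le> a / 2 * norm (norm \<xi> powr \<beta>)) (at 0)"
    using landau_o.smallD[OF J0_exp, of "a / 2"] a by simp
  then obtain d where d: "0 < d"
    "\<And>\<xi>. \<xi> \<noteq> 0 \<Longrightarrow> norm \<xi> < d \<Longrightarrow> \<bar>J0 \<xi> - (1 - a * norm \<xi> powr \<beta>)\<bar> \<le> a / 2 * norm \<xi> powr \<beta>"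
    unfolding eventually_at by auto
  \<comment> \<open>The cap at 1 keeps \<open>norm \<xi> powr \<beta>\<close> at most 1 in the
    low-frequency region.\<close>
  define r where "r = min d 1"
  have r: "0 < r" "r \<le> 1" using d(1) by (auto simp: r_def)
  obtain c where c: "c < 1" "\<And>\<xi>. r \<le> norm \<xi> \<Longrightarrow> J0 \<xi> \<le> c" using J0_sup r(1) by blast
  show ?thesis
  proof (rule that[of r "1 - c"])
    \<comment> \<open>At \<open>\<xi> = 0\<close> the expansion says nothing; there the claim
      reduces to \<open>le1\<close>.\<close>
    fix \<xi> :: "real^'n" assume "norm \<xi> < r"
    then show "J0 \<xi> - 1 \<le> - (a / 2 * norm \<xi> powr \<beta>)"
      using abs_le_D1[OF d(2)[of \<xi>]] le1[of \<xi>] by (cases "\<xi> = 0") (auto simp: r_def field_simps)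
  next
    fix \<xi> :: "real^'n" assume "r \<le> norm \<xi>"
    then show "J0 \<xi> - 1 \<le> - (1 - c)" using c(2)[of \<xi>] by simp
  qed (use r c in auto)
qed

text \<open>Low frequencies decay at the algebraic rate through the bound linear in
  \<open>norm \<xi>\<close>; high frequencies decay exponentially against the L1 norm of
  \<open>F\<close>. The constant is fixed before \<open>F\<close>, \<open>m\<close>,
  \<open>L\<close> and \<open>t\<close>, which lets the smallness threshold be chosen before the
  datum.\<close>

lemma symbol_decay:
  fixes J0 :: "real^'n::finite \<Rightarrow> real"
  assumes a: "0 < a" and \<beta>: "0 < \<beta>"
    and J0_exp: "(\<lambda>\<xi>. J0 \<xi> - (1 - a * norm \<xi> powr \<beta>)) \<in> o[at 0](\<lambda>\<xi>. norm \<xi> powr \<beta>)"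
    and J0_sup: "\<forall>r>0. \<exists>c<1. \<forall>\<xi>. r \<le> norm \<xi> \<longrightarrow> J0 \<xi> \<le> c"
    and le1: "\<And>\<xi>. J0 \<xi> \<le> 1"
  obtains C where "0 < C"
    "\<And>(F :: real^'n \<Rightarrow> complex) m L t. F \<in> borel_measurable borel \<Longrightarrow> 0 \<le> m \<Longrightarrow> (\<And>\<xi>. norm (F \<xi>) \<le> 2 * m * norm \<xi>) \<Longrightarrow>
       0 \<le> L \<Longrightarrow> (\<integral>\<^sup>+\<xi>. ennreal (norm (F \<xi>)) \<partial>lborel) \<le> ennreal L \<Longrightarrow> 0 \<le> t \<Longrightarrow>
       (\<integral>\<^sup>+\<xi>. ennreal (norm (F \<xi>) * exp (t * (J0 \<xi> - 1))) \<partial>lborel)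
         \<le> ennreal (C * (m + L) * (1 + t) powr (- (real CARD('n) + 1) / \<beta>))"
proof -
  obtain r \<delta> where r: "0 < r" "r \<le> 1" and \<delta>: "0 < \<delta>"
    and near: "\<And>\<xi>. norm \<xi> < r \<Longrightarrow> J0 \<xi> - 1 \<le> - (a / 2 * norm \<xi> powr \<beta>)"
    and far: "\<And>\<xi>. r \<le> norm \<xi> \<Longrightarrow> J0 \<xi> - 1 \<le> - \<delta>"
    by (rule symbol_bounds[OF a J0_exp J0_sup le1]) blast
  define c where "c = a / 2"
  have c: "0 < c" using a by (simp add: c_def)
  let ?q = "(real CARD('n) + 1) / \<beta>"
  obtain C1 where C1: "0 < C1" "\<And>y. 1 \<le> y \<Longrightarrow> y powr ?q * exp (- (\<delta> * y)) \<le> C1"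
    by (rule powr_mult_exp_bounded[OF \<delta>]) blast
  obtain i where i: "0 \<le> i" "(\<integral>\<^sup>+\<xi>. ennreal (norm \<xi> * exp (- (c * norm \<xi> powr \<beta>))) \<partial>(lborel :: (real^'n) measure)) = ennreal i"
    using nn_integral_norm_exp_powr_finite[OF c \<beta>, where 'a="real^'n"] by (auto simp: less_top_ennreal)
  \<comment> \<open>The low-frequency constant, multiplying \<open>m\<close>, plus the
    high-frequency constant, multiplying \<open>L\<close>.\<close>
  define C where "C = 2 * exp c * i + C1 * exp \<delta>"
  have C0: "0 < C" unfolding C_def using C1(1) i(1) by (intro add_nonneg_pos) auto
  show ?thesis
  proof (rule that[OF C0])
    fix F :: "real^'n \<Rightarrow> complex" and m L t :: real
    assume Fm[measurable]: "F \<in> borel_measurable borel" and m: "0 \<le> m" and F: "\<And>\<xi>. norm (F \<xi>) \<le> 2 * m * norm \<xi>"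
      and L: "0 \<le> L" "(\<integral>\<^sup>+\<xi>. ennreal (norm (F \<xi>)) \<partial>lborel) \<le> ennreal L" and t: "0 \<le> t"
    let ?p = "(1 + t) powr (- ?q)"
    \<comment> \<open>The power bound is used at \<open>1 + t\<close>, which is at least 1; the
      shift costs \<open>exp \<delta>\<close>.\<close>
    have far_t: "exp (- (\<delta> * t)) \<le> C1 * exp \<delta> * ?p"
    proof -
      have "(1 + t) powr ?q * exp (- (\<delta> * (1 + t))) \<le> C1" using t by (intro C1) auto
      then have "exp (- (\<delta> * (1 + t))) \<le> C1 * ?p" using t by (simp add: powr_minus field_simps)
      then have "exp \<delta> * exp (- (\<delta> * (1 + t))) \<le> exp \<delta> * (C1 * ?p)" by (intro mult_left_mono) auto
      moreover have "exp \<delta> * exp (- (\<delta> * (1 + t))) = exp (- (\<delta> * t))"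
        by (simp add: exp_add[symmetric] algebra_simps)
      ultimately show ?thesis by (simp add: mult_ac)
    qed
    have pt: "norm (F \<xi>) * exp (t * (J0 \<xi> - 1))
        \<le> (2 * m * exp c) * (norm \<xi> * exp (- (c * (1 + t) * norm \<xi> powr \<beta>))) + (C1 * exp \<delta> * ?p) * norm (F \<xi>)" for \<xi>
    proof (cases "norm \<xi> < r")
      case True
      have "norm \<xi> powr \<beta> \<le> 1 powr \<beta>" using True r \<beta> by (intro powr_mono2) auto
      \<comment> \<open>This allows \<open>1 + t\<close> in place of \<open>t\<close> in the
        exponent at the price of \<open>exp c\<close>, so the estimate stays finite at
        \<open>t = 0\<close>.\<close>
      then have "c * norm \<xi> powr \<beta> \<le> c" using c by (simp add: mult_left_le)
      moreover have "t * (J0 \<xi> - 1) \<le> t * (- (c * norm \<xi> powr \<beta>))"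
        using near[OF True] t by (intro mult_left_mono) (auto simp: c_def)
      ultimately have "t * (J0 \<xi> - 1) \<le> c + - (c * (1 + t) * norm \<xi> powr \<beta>)"
        by (simp add: algebra_simps)
      then have "exp (t * (J0 \<xi> - 1)) \<le> exp c * exp (- (c * (1 + t) * norm \<xi> powr \<beta>))"
        unfolding exp_add[symmetric] by simp
      then have "norm (F \<xi>) * exp (t * (J0 \<xi> - 1)) \<le> (2 * m * norm \<xi>) * (exp c * exp (- (c * (1 + t) * norm \<xi> powr \<beta>)))"
        using m by (intro mult_mono F) auto
      moreover have "0 \<le> (C1 * exp \<delta> * ?p) * norm (F \<xi>)" using C1(1) by (intro mult_nonneg_nonneg) auto
      ultimately show ?thesis by (simp add: mult_ac)
    next
      case False
      then have "t * (J0 \<xi> - 1) \<le> t * (- \<delta>)" using far[of \<xi>] t by (intro mult_left_mono) auto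
      then have "exp (t * (J0 \<xi> - 1)) \<le> exp (- (\<delta> * t))" by (simp add: mult_ac)
      also note far_t
      finally have "norm (F \<xi>) * exp (t * (J0 \<xi> - 1)) \<le> norm (F \<xi>) * (C1 * exp \<delta> * ?p)" by (intro mult_left_mono) auto
      moreover have "0 \<le> (2 * m * exp c) * (norm \<xi> * exp (- (c * (1 + t) * norm \<xi> powr \<beta>)))"
        using m by (intro mult_nonneg_nonneg) auto
      ultimately show ?thesis by (simp add: mult_ac)
    qed
    have "(\<integral>\<^sup>+\<xi>. ennreal (norm (F \<xi>) * exp (t * (J0 \<xi> - 1))) \<partial>lborel)
        \<le> (\<integral>\<^sup>+\<xi>. ennreal (2 * m * exp c) * ennreal (norm \<xi> * exp (- (c * (1 + t) * norm \<xi> powr \<beta>)))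
             + ennreal (C1 * exp \<delta> * ?p) * ennreal (norm (F \<xi>)) \<partial>lborel)"
      using m C1(1) by (intro nn_integral_mono) (auto simp: ennreal_mult[symmetric] ennreal_plus[symmetric] simp del: ennreal_plus intro!: ennreal_leI pt)
    also have "\<dots> = ennreal (2 * m * exp c) * (\<integral>\<^sup>+\<xi>. ennreal (norm \<xi> * exp (- (c * (1 + t) * norm \<xi> powr \<beta>))) \<partial>(lborel :: (real^'n) measure))
             + ennreal (C1 * exp \<delta> * ?p) * (\<integral>\<^sup>+\<xi>. ennreal (norm (F \<xi>)) \<partial>lborel)"
      by (simp add: nn_integral_add nn_integral_cmult)
    also have "\<dots> \<le> ennreal (2 * m * exp c) * (ennreal ?p * ennreal i) + ennreal (C1 * exp \<delta> * ?p) * ennreal L"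
      using nn_integral_norm_exp_powr_scale[of "1 + t" \<beta> c, where 'a="real^'n"] t \<beta> i(2) L(2)
      by (intro add_mono mult_left_mono) auto
    also have "\<dots> = ennreal ((2 * m * exp c) * (?p * i) + (C1 * exp \<delta> * ?p) * L)"
      using m i(1) L(1) C1(1) by (simp add: ennreal_mult ennreal_plus)
    also have "\<dots> \<le> ennreal (C * (m + L) * ?p)"
    proof (rule ennreal_leI)
      have "0 \<le> (2 * exp c * i) * L * ?p" "0 \<le> (C1 * exp \<delta>) * m * ?p"
        using m i(1) L(1) C1(1) by auto
      moreover have "C * (m + L) * ?p = (2 * m * exp c) * (?p * i) + (C1 * exp \<delta> * ?p) * L + ((2 * exp c * i) * L * ?p + (C1 * exp \<delta>) * m * ?p)"
        by (simp add: C_def algebra_simps)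
      ultimately show "(2 * m * exp c) * (?p * i) + (C1 * exp \<delta> * ?p) * L \<le> C * (m + L) * ?p" by linarith
    qed
    finally show "(\<integral>\<^sup>+\<xi>. ennreal (norm (F \<xi>) * exp (t * (J0 \<xi> - 1))) \<partial>lborel)
         \<le> ennreal (C * (m + L) * (1 + t) powr (- (real CARD('n) + 1) / \<beta>))"
      by (simp only: minus_divide_left)
  qed
qed

section \<open>The linear flow as a Fourier multiplier\<close>

locale half_space_semigroup = half_space_kernel k G
  for k :: "'n::finite" and G :: "real \<Rightarrow> (real^'n) measure" +
  fixes J0 :: "real^'n \<Rightarrow> real"
  assumes J0_cont: "continuous_on UNIV J0"
    and G_fourier: "\<And>t \<xi>. 0 < t \<Longrightarrow> fourier_measure (G t) \<xi> = complex_of_real (exp (t * (J0 \<xi> - 1)))"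
begin

lemma J0_measurable [measurable]: "J0 \<in> borel_measurable borel"
  using J0_cont by (rule borel_measurable_continuous_onI)

lemma K_fourier: "0 \<le> t \<Longrightarrow> (\<integral>y. cis (- (y \<bullet> \<xi>)) \<partial>K t) = complex_of_real (exp (t * (J0 \<xi> - 1)))"
  using G_fourier[of t \<xi>] by (cases "t = 0") (auto simp: fourier_measure_def K_def integral_return)

text \<open>At time 1 the exponential of \<open>J0 \<xi> - 1\<close> is the modulus of a Fourier
  transform of a probability measure.\<close>

lemma J0_le_1: "J0 \<xi> \<le> 1"
proof -
  interpret K: prob_space "K 1" by (rule prob_space_K)
  have "exp (J0 \<xi> - 1) = norm (\<integral>y. cis (- (y \<bullet> \<xi>)) \<partial>K 1)"
    by (subst K_fourier) auto
  also have "\<dots> \<le> (\<integral>y. norm (cis (- (y \<bullet> \<xi>))) \<partial>K 1)" by (rule integral_norm_bound)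
  also have "\<dots> = 1" using K.prob_space by simp
  finally show ?thesis by simp
qed

definition flow :: "(real^'n \<Rightarrow> complex) \<Rightarrow> real \<Rightarrow> real^'n \<Rightarrow> complex" where
  "flow F t x = (\<integral>\<xi>. cis (x \<bullet> \<xi>) * F \<xi> * complex_of_real (exp (t * (J0 \<xi> - 1))) \<partial>lborel)"

context
  fixes F :: "real^'n \<Rightarrow> complex"
  assumes F: "integrable lborel F"
begin

lemma F_measurable [measurable]: "F \<in> borel_measurable borel"
  using F by auto

lemma flow_integrand_le:
  "0 \<le> t \<Longrightarrow> norm (cis z * F \<xi> * complex_of_real (exp (t * (J0 \<xi> - 1)))) \<le> norm (F \<xi>)"
  using J0_le_1[of \<xi>] by (simp add: norm_mult mult_left_le mult_nonneg_nonpos)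

lemma integrable_flow_integrand:
  "0 \<le> t \<Longrightarrow> integrable lborel (\<lambda>\<xi>. cis (x \<bullet> \<xi>) * F \<xi> * complex_of_real (exp (t * (J0 \<xi> - 1))))"
  by (rule Bochner_Integration.integrable_bound[OF F]) (auto intro!: AE_I2 flow_integrand_le)

lemma norm_flow_le:
  assumes "0 \<le> t" "0 \<le> c" "(\<integral>\<^sup>+\<xi>. ennreal (norm (F \<xi>) * exp (t * (J0 \<xi> - 1))) \<partial>lborel) \<le> ennreal c"
  shows "norm (flow F t x) \<le> c"
proof -
  have "ennreal (norm (flow F t x)) \<le> (\<integral>\<^sup>+\<xi>. ennreal (norm (cis (x \<bullet> \<xi>) * F \<xi> * complex_of_real (exp (t * (J0 \<xi> - 1))))) \<partial>lborel)"
    unfolding flow_def by (intro integral_norm_bound_ennreal integrable_flow_integrand assms)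
  also have "\<dots> \<le> ennreal c" using assms(3) by (simp add: norm_mult)
  finally show ?thesis using assms(2) by simp
qed

lemma norm_flow_le_L1: "0 \<le> t \<Longrightarrow> norm (flow F t x) \<le> (\<integral>\<xi>. norm (F \<xi>) \<partial>lborel)"
  unfolding flow_def
  by (intro order_trans[OF integral_norm_bound] integral_mono integrable_norm F integrable_flow_integrand flow_integrand_le)

lemma flow_measurable: "(\<lambda>p. flow F (max 0 (fst p)) (snd p)) \<in> borel_measurable borel"
proof -
  have "(\<lambda>p. flow F (max 0 (fst p)) (snd p)) \<in> borel_measurable (borel \<Otimes>\<^sub>M borel)"
    unfolding flow_def by (intro lborel.borel_measurable_lebesgue_integral) measurable
  then show ?thesis by (simp add: borel_prod)
qed

lemma flow_measurable_slice: "0 \<le> t \<Longrightarrow> flow F t \<in> borel_measurable borel"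
  using measurable_compose[OF _ flow_measurable, of "\<lambda>x. (t, x)" borel] by simp

lemma continuous_on_flow:
  assumes t: "0 \<le> t"
  shows "continuous_on UNIV (flow F t)"
  unfolding continuous_on_sequentially
proof (intro allI ballI impI)
  fix x :: "nat \<Rightarrow> real^'n" and a assume "(\<forall>n. x n \<in> UNIV) \<and> x \<longlonglongrightarrow> a"
  then have x: "x \<longlonglongrightarrow> a" by simp
  have "(\<lambda>n. flow F t (x n)) \<longlonglongrightarrow> flow F t a"
    unfolding flow_def
  proof (rule integral_dominated_convergence[where w="\<lambda>\<xi>. norm (F \<xi>)"])
    show "AE \<xi> in lborel. (\<lambda>n. cis (x n \<bullet> \<xi>) * F \<xi> * complex_of_real (exp (t * (J0 \<xi> - 1))))
        \<longlonglongrightarrow> cis (a \<bullet> \<xi>) * F \<xi> * complex_of_real (exp (t * (J0 \<xi> - 1)))"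
    proof (intro AE_I2 tendsto_mult tendsto_const)
      fix \<xi>
      have "isCont cis (a \<bullet> \<xi>)"
        using continuous_on_cis_compose[OF continuous_on_id, of UNIV] by (simp add: continuous_on_eq_continuous_at)
      then show "(\<lambda>n. cis (x n \<bullet> \<xi>)) \<longlonglongrightarrow> cis (a \<bullet> \<xi>)"
        by (rule isCont_tendsto_compose) (intro tendsto_inner x tendsto_const)
    qed
  qed (use F t in \<open>auto intro!: AE_I2 flow_integrand_le\<close>)
  then show "(flow F t \<circ> x) \<longlonglongrightarrow> flow F t a" by (simp add: comp_def)
qed

text \<open>After Fubini the kernel acts on the plane wave \<open>cis (x \<bullet> \<xi>)\<close> by
  multiplication with its symbol, and the exponentials combine. The identity holds at every
  \<open>x\<close>.\<close>

lemma integral_flow_K: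
  assumes r: "0 \<le> r" and s: "0 \<le> s"
  shows "(\<integral>y. flow F s (x - y) \<partial>K r) = flow F (r + s) x"
proof -
  interpret K: prob_space "K r" by (rule prob_space_K)
  interpret P: pair_sigma_finite "K r" "lborel :: (real^'n) measure" by standard
  let ?h = "\<lambda>y \<xi>. cis ((x - y) \<bullet> \<xi>) * F \<xi> * complex_of_real (exp (s * (J0 \<xi> - 1)))"
  have "(\<integral>y. flow F s (x - y) \<partial>K r) = (\<integral>\<xi>. (\<integral>y. ?h y \<xi> \<partial>K r) \<partial>lborel)"
    unfolding flow_def
    by (rule P.Fubini_product_bound(2)[symmetric, where f="\<lambda>_. 1" and g="\<lambda>\<xi>. norm (F \<xi>)"])
       (use F flow_integrand_le[OF s] in auto)
  also have "\<dots> = (\<integral>\<xi>. cis (x \<bullet> \<xi>) * F \<xi> * complex_of_real (exp ((r + s) * (J0 \<xi> - 1))) \<partial>lborel)"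
  proof (intro Bochner_Integration.integral_cong refl)
    fix \<xi>
    have "(\<integral>y. ?h y \<xi> \<partial>K r) = (\<integral>y. (cis (x \<bullet> \<xi>) * F \<xi> * complex_of_real (exp (s * (J0 \<xi> - 1)))) * cis (- (y \<bullet> \<xi>)) \<partial>K r)"
      by (intro Bochner_Integration.integral_cong refl) (simp add: inner_diff_left cis_divide[symmetric] cis_inverse[symmetric] field_simps)
    also have "\<dots> = cis (x \<bullet> \<xi>) * F \<xi> * complex_of_real (exp (s * (J0 \<xi> - 1))) * complex_of_real (exp (r * (J0 \<xi> - 1)))"
      by (simp add: K_fourier[OF r])
    also have "\<dots> = cis (x \<bullet> \<xi>) * F \<xi> * complex_of_real (exp ((r + s) * (J0 \<xi> - 1)))"
      by (simp add: distrib_right exp_add)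
    finally show "(\<integral>y. ?h y \<xi> \<partial>K r) = cis (x \<bullet> \<xi>) * F \<xi> * complex_of_real (exp ((r + s) * (J0 \<xi> - 1)))" .
  qed
  finally show ?thesis by (simp add: flow_def)
qed

text \<open>Taking the real part makes the function real by construction; clamping time at 0 gives
  the bounds for all real \<open>t\<close>.\<close>

definition lin_flow :: "real \<Rightarrow> real^'n \<Rightarrow> real" where
  "lin_flow t x = Re (flow F (max 0 t) x) / (2 * pi) ^ CARD('n)"

lemma lin_flow_measurable: "(\<lambda>p. lin_flow (fst p) (snd p)) \<in> borel_measurable borel"
  unfolding lin_flow_def using flow_measurable by measurable

lemma abs_lin_flow_le: "norm (flow F (max 0 t) x) \<le> c \<Longrightarrow> \<bar>lin_flow t x\<bar> \<le> c"
proof -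
  assume c: "norm (flow F (max 0 t) x) \<le> c"
  have "1 \<le> (2 * pi) ^ CARD('n)" using pi_gt3 by (intro one_le_power) auto
  then have "\<bar>lin_flow t x\<bar> \<le> \<bar>Re (flow F (max 0 t) x)\<bar>"
    unfolding lin_flow_def by (simp add: divide_le_eq mult_le_cancel_left1 mult_left_le)
  then show ?thesis using c abs_Re_le_cmod[of "flow F (max 0 t) x"] by linarith
qed

lemma continuous_on_lin_flow: "continuous_on UNIV (lin_flow t)"
  unfolding lin_flow_def by (intro continuous_intros continuous_on_Re continuous_on_flow) auto

lemma conv_K_lin_flow:
  assumes "0 \<le> r" "0 \<le> s"
  shows "conv (K r) (lin_flow s) x = lin_flow (r + s) x"
proof -
  interpret K: prob_space "K r" by (rule prob_space_K)
  have m: "(\<lambda>y. flow F s (x - y)) \<in> borel_measurable (K r)"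
    using measurable_compose[OF _ flow_measurable_slice[OF assms(2)], of "\<lambda>y. x - y" "K r"] by simp
  have i: "integrable (K r) (\<lambda>y. flow F s (x - y))"
    by (rule K.integrable_const_bound[OF _ m]) (use norm_flow_le_L1[OF assms(2)] in auto)
  have "conv (K r) (lin_flow s) x = (\<integral>y. Re (flow F s (x - y)) \<partial>K r) / (2 * pi) ^ CARD('n)"
    using assms by (simp add: conv_def lin_flow_def)
  also have "(\<integral>y. Re (flow F s (x - y)) \<partial>K r) = Re (flow F (r + s) x)"
    using i by (simp add: integral_flow_K[OF assms, symmetric])
  finally show ?thesis using assms by (simp add: lin_flow_def[of "r + s"])
qed

end

end

section \<open>Global solutions\<close>

text \<open>Serves to exchange \<open>K (t - s)\<close> for \<open>G (t - s)\<close>, which can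
  differ at \<open>s = t\<close> only.\<close>

lemma lborel_modify_point:
  fixes f g :: "'a::euclidean_space \<Rightarrow> 'b::{banach, second_countable_topology}"
  assumes f: "integrable lborel f" and eq: "\<And>s. s \<noteq> c \<Longrightarrow> g s = f s"
  shows "integrable lborel g" "integral\<^sup>L lborel g = integral\<^sup>L lborel f"
proof -
  have [measurable]: "f \<in> borel_measurable borel" using f by auto
  have "(\<lambda>s. if s = c then g c else f s) \<in> borel_measurable borel" by measurable
  also have "(\<lambda>s. if s = c then g c else f s) = g" using eq by auto
  finally have g[measurable]: "g \<in> borel_measurable borel" .
  have ae: "AE s in lborel. f s = g s"
    using AE_lborel_singleton[of c] by eventually_elim (simp add: eq)
  show "integrable lborel g"
    by (rule integrable_cong_AE_imp[OF f _ ae]) simp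
  show "integral\<^sup>L lborel g = integral\<^sup>L lborel f"
    by (rule integral_cong_AE) (use ae in \<open>auto elim: eventually_mono\<close>)
qed

context half_space_kernel
begin

text \<open>\<open>K t\<close> may be singular, so equality almost everywhere need not survive at a
  given \<open>x\<close>. For each \<open>y\<close> the translate of the exceptional set is null,
  and Fubini for null sets exchanges the quantifiers.\<close>

lemma AE_K_translate:
  assumes ae: "AE x in lborel. f x = g x"
    and [measurable]: "f \<in> borel_measurable borel" "g \<in> borel_measurable borel"
  shows "AE x in lborel. AE y in K t. f (x - y) = (g (x - y) :: real)"
proof -
  interpret K: prob_space "K t" by (rule prob_space_K)
  interpret P: pair_sigma_finite "lborel :: (real^'n) measure" "K t" by standard
  have tr: "AE x in lborel. f (x - y) = g (x - y)" for y
  proof -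
    have "distr lborel borel (\<lambda>x. x - y) = (lborel :: (real^'n) measure)"
      using lborel_affine[of 1 "- y"] by (simp add: density_1)
    then have "AE x in distr lborel borel (\<lambda>x. x - y). f x = g x" by (simp only: ae)
    then show ?thesis by (subst (asm) AE_distr_iff) auto
  qed
  have "{p \<in> space (lborel \<Otimes>\<^sub>M K t). f (fst p - snd p) = g (fst p - snd p)} \<in> sets (lborel \<Otimes>\<^sub>M K t)"
    by measurable
  then have "(AE x in lborel. AE y in K t. f (x - y) = g (x - y)) \<longleftrightarrow> (AE y in K t. AE x in lborel. f (x - y) = g (x - y))"
    by (rule P.AE_commute)
  then show ?thesis using tr by simp
qed

end

section \<open>From the linear flow of a datum to a global mild solution\<close>

context half_space_semigroup
begin

context
  fixes u0 :: "real^'n \<Rightarrow> real"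
  assumes u0: "init_data k u0" and F: "integrable lborel (fourier (oddext k u0))"
begin

abbreviation "w0 \<equiv> oddext k u0"
abbreviation "V \<equiv> lin_flow (fourier w0)"

lemma w0_measurable [measurable]: "w0 \<in> borel_measurable borel"
  using u0 by (intro borel_measurable_oddext) (simp add: init_data_def)

lemma V_0_AE: "AE x in lborel. V 0 x = w0 x"
proof -
  have "integrable lborel w0" using u0 by (intro integrable_oddext) (simp add: init_data_def)
  from fourier_inversion[OF this F] show ?thesis
  proof eventually_elim
    case (elim x)
    have "complex_of_real (w0 x) = flow (fourier w0) 0 x / complex_of_real ((2 * pi) ^ CARD('n))"
      using elim by (simp add: flow_def)
    then have "Re (complex_of_real (w0 x)) = Re (flow (fourier w0) 0 x / complex_of_real ((2 * pi) ^ CARD('n)))"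
      by (rule arg_cong)
    then show ?case unfolding lin_flow_def[OF F] Re_divide_of_real by simp
  qed
qed

text \<open>The datum is odd, the reflection preserves null sets, and continuity removes the
  exceptional set; equality comes from two inequalities.\<close>

lemma V_0_odd: "V 0 (reflN k x) = - V 0 x"
proof -
  have c: "continuous_on UNIV (V 0)" by (rule continuous_on_lin_flow[OF F])
  have c2: "continuous_on UNIV (\<lambda>x. V 0 (reflN k x))"
    by (intro continuous_on_compose2[OF c] continuous_intros) auto
  have m: "V 0 \<in> borel_measurable borel" using c by (rule borel_measurable_continuous_onI)
  have "AE x in distr lborel borel (reflN k). V 0 x = w0 x" unfolding lborel_distr_reflN by (rule V_0_AE)
  then have "AE x in lborel. V 0 (reflN k x) = w0 (reflN k x)"
    using m by (subst (asm) AE_distr_iff) auto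
  then have ae: "AE x in lborel. V 0 (reflN k x) + V 0 x = 0"
    using V_0_AE by eventually_elim (simp add: oddext_reflN)
  have "0 \<le> V 0 (reflN k x) + V 0 x"
    by (rule AE_lborel_open_continuous_nonneg[of UNIV]) (use ae c c2 in \<open>auto intro: continuous_on_add elim: eventually_mono\<close>)
  moreover have "0 \<le> - (V 0 (reflN k x) + V 0 x)"
    by (rule AE_lborel_open_continuous_nonneg[of UNIV]) (use ae c c2 in \<open>auto intro!: continuous_on_add continuous_on_diff continuous_on_minus elim: eventually_mono\<close>)
  ultimately show ?thesis by simp
qed

lemma V_0_nonneg:
  assumes "x \<in> halfspace k"
  shows "0 \<le> V 0 x"
proof (rule AE_lborel_open_continuous_nonneg[OF open_halfspace _ _ assms])
  show "continuous_on (halfspace k) (V 0)"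
    by (rule continuous_on_subset[OF continuous_on_lin_flow[OF F]]) simp
  have "AE x in lborel. x \<in> halfspace k \<longrightarrow> 0 \<le> u0 x" using u0 by (simp add: init_data_def)
  then show "AE x in lborel. x \<in> halfspace k \<longrightarrow> 0 \<le> V 0 x"
    using V_0_AE by eventually_elim (simp add: oddext_def halfspace_def)
qed

lemma V_0_bounded: obtains B where "\<And>x. \<bar>V 0 x\<bar> \<le> B"
proof (rule that)
  show "\<bar>V 0 x\<bar> \<le> (\<integral>\<xi>. norm (fourier w0 \<xi>) \<partial>lborel)" for x
    by (rule abs_lin_flow_le[OF F norm_flow_le_L1[OF F]]) simp
qed

lemma V_0_measurable: "V 0 \<in> borel_measurable borel"
  by (rule borel_measurable_continuous_onI[OF continuous_on_lin_flow[OF F]])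

text \<open>Lets the kernel carry oddness and sign from time 0 to all times.\<close>

lemma V_eq_conv: "V t x = conv (K (max 0 t)) (V 0) x"
  by (subst conv_K_lin_flow[OF F]) (simp_all add: lin_flow_def[OF F])

lemma V_odd: "V t (reflN k x) = - V t x"
  unfolding V_eq_conv[of t] by (rule conv_K_odd[OF V_0_measurable V_0_odd])

lemma V_nonneg:
  assumes "x \<in> halfspace k"
  shows "0 \<le> V t x"
proof -
  obtain B where "\<And>x. \<bar>V 0 x\<bar> \<le> B" using V_0_bounded by blast
  from conv_K_nonneg[OF V_0_measurable this V_0_odd V_0_nonneg assms]
  show ?thesis unfolding V_eq_conv[of t] .
qed

lemma conv_G_w0_AE:
  assumes t: "0 < t"
  shows "AE x in lborel. integrable (G t) (\<lambda>y. w0 (x - y)) \<and> conv (G t) w0 x = V t x"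
proof -
  obtain B where B: "\<And>x. \<bar>V 0 x\<bar> \<le> B" using V_0_bounded by blast
  note [measurable] = V_0_measurable
  have "AE x in lborel. AE y in K t. w0 (x - y) = V 0 (x - y)"
    using V_0_AE by (intro AE_K_translate) (auto elim: eventually_mono)
  then show ?thesis
  proof eventually_elim
    case (elim x)
    have "integrable (K t) (\<lambda>y. V 0 (x - y))" by (rule integrable_conv_K[OF V_0_measurable B])
    then have "integrable (K t) (\<lambda>y. w0 (x - y))"
      by (rule integrable_cong_AE_imp) (use elim in \<open>auto elim: eventually_mono\<close>)
    moreover have "conv (K t) w0 x = conv (K t) (V 0) x"
      unfolding conv_def by (rule integral_cong_AE) (use elim in auto)
    ultimately show ?case using t V_eq_conv[of t x] by (simp add: K_def)
  qed
qed

theorem global_solution: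
  assumes \<alpha>: "0 < \<alpha>" and V_le: "\<And>t x. \<bar>V t x\<bar> \<le> b t" and b_le: "\<And>t. b t \<le> B0"
    and b_integrable: "\<And>t. set_integrable lborel {0..t} (\<lambda>s. b s powr \<alpha>)"
    and b_small: "\<And>t. 2 powr (1 + \<alpha>) * (LINT s : {0..t} | lborel. b s powr \<alpha>) \<le> 1"
  obtains u where "\<And>T. 0 < T \<Longrightarrow> mild_sol G \<alpha> w0 T u" "\<And>t x. \<bar>u t x\<bar> \<le> 2 * b t"
proof -
  interpret duhamel_supersolution k G V b \<alpha> B0
  proof unfold_locales
    show "(\<lambda>p. V (fst p) (snd p)) \<in> borel_measurable borel" by (rule lin_flow_measurable[OF F])
    show "conv (K (t - s)) (V s) x = V t x" if "0 \<le> s" "s \<le> t" for s t x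
      using conv_K_lin_flow[OF F, of "t - s" s x] that by simp
  qed (fact \<alpha> V_le b_le b_integrable b_small V_odd V_nonneg)+
  let ?M = "2 * B0"
  have bd: "\<bar>sol t x\<bar> \<le> 2 * b t" for t x by (rule admissible_abs_le[OF admissible_sol])
  show ?thesis
  proof (rule that[OF _ bd])
    fix T :: ereal assume T: "0 < T"
    show "mild_sol G \<alpha> w0 T sol"
      unfolding mild_sol_def
    proof (intro conjI allI impI T)
      show "(\<lambda>p. sol (fst p) (snd p)) \<in> borel_measurable (lborel \<Otimes>\<^sub>M lborel)"
        using admissibleD(1)[OF admissible_sol] by (simp add: lborel_prod)
      show "\<exists>M. \<forall>s\<in>{0..T'}. \<forall>x. \<bar>sol s x\<bar> \<le> M" for T'
      proof (intro exI[of _ ?M] ballI allI)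
        show "\<bar>sol s x\<bar> \<le> ?M" for s x using bd[of s x] b_le[of s] by linarith
      qed
      \<comment> \<open>The interval \<open>{0..0}\<close> is Lebesgue-null, so the Duhamel integral
        vanishes.\<close>
      have "sol 0 x = V 0 x" for x
      proof -
        have "AE s in lborel. s \<noteq> (0::real)" by (rule AE_lborel_singleton)
        then have "(LINT s : {0..0} | lborel. conv (K (0 - s)) (\<lambda>z. nl \<alpha> (sol s z)) x) = 0"
          unfolding set_lebesgue_integral_def
          by (intro integral_eq_zero_AE) (auto elim!: eventually_mono)
        then show ?thesis using sol_duhamel[of 0 x] by (simp add: duhamel_def)
      qed
      then show "AE x in lborel. sol 0 x = w0 x" using V_0_AE by simp
    next
      fix t assume "0 < t \<and> ereal t < T"
      then have t: "0 < t" by simp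
      \<comment> \<open>Returns from \<open>K\<close> to \<open>G\<close>: the value at
        \<open>s = t\<close> does not affect the integral.\<close>
      have GK: "set_integrable lborel {0..t} (\<lambda>s. conv (G (t - s)) (\<lambda>z. nl \<alpha> (sol s z)) x)"
          "(LINT s : {0..t} | lborel. conv (G (t - s)) (\<lambda>z. nl \<alpha> (sol s z)) x)
            = (LINT s : {0..t} | lborel. conv (K (t - s)) (\<lambda>z. nl \<alpha> (sol s z)) x)" for x
      proof -
        let ?g = "\<lambda>s. indicator {0..t} s *\<^sub>R conv (G (t - s)) (\<lambda>z. nl \<alpha> (sol s z)) x"
        let ?k = "\<lambda>s. indicator {0..t} s *\<^sub>R conv (K (t - s)) (\<lambda>z. nl \<alpha> (sol s z)) x"
        have k: "integrable lborel ?k"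
          using source_integrable[OF admissible_sol, of t x] unfolding set_integrable_def .
        have eq: "?g s = ?k s" if "s \<noteq> t" for s
          using that by (auto simp: indicator_def K_def)
        show "set_integrable lborel {0..t} (\<lambda>s. conv (G (t - s)) (\<lambda>z. nl \<alpha> (sol s z)) x)"
          unfolding set_integrable_def by (rule lborel_modify_point(1)[OF k eq])
        show "(LINT s : {0..t} | lborel. conv (G (t - s)) (\<lambda>z. nl \<alpha> (sol s z)) x)
            = (LINT s : {0..t} | lborel. conv (K (t - s)) (\<lambda>z. nl \<alpha> (sol s z)) x)"
          unfolding set_lebesgue_integral_def by (rule lborel_modify_point(2)[OF k eq])
      qed
      show "AE x in lborel. integrable (G t) (\<lambda>y. w0 (x - y)) \<and>
           set_integrable lborel {0..t} (\<lambda>s. conv (G (t - s)) (\<lambda>z. nl \<alpha> (sol s z)) x) \<and>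
           sol t x = conv (G t) w0 x + (LINT s : {0..t} | lborel. conv (G (t - s)) (\<lambda>z. nl \<alpha> (sol s z)) x)"
        using conv_G_w0_AE[OF t]
      proof eventually_elim
        case (elim x)
        then show ?case using GK[of x] sol_duhamel[of t x] by (simp add: duhamel_def)
      qed
    qed
  qed
qed

end

end

text \<open>The explicit antiderivative gives a bound independent of \<open>t\<close>. This
  uniformity is what makes one smallness condition valid on every time interval.\<close>

lemma
  fixes p t :: real
  assumes p: "1 < p"
  shows set_integrable_powr_decay: "set_integrable lborel {0..t} (\<lambda>s. (1 + s) powr (- p))"
    and set_integral_powr_decay_le: "(LINT s : {0..t} | lborel. (1 + s) powr (- p)) \<le> 1 / (p - 1)"
proof -
  show "set_integrable lborel {0..t} (\<lambda>s. (1 + s) powr (- p))"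
    by (intro borel_integrable_atLeastAtMost' continuous_intros) auto
  show "(LINT s : {0..t} | lborel. (1 + s) powr (- p)) \<le> 1 / (p - 1)"
  proof (cases "0 \<le> t")
    case True
    have "(\<integral>s. (1 + s) powr (- p) * indicator {0..t} s \<partial>lborel)
        = - ((1 + t) powr (1 - p) / (p - 1)) - (- ((1 + 0) powr (1 - p) / (p - 1)))"
    proof (rule integral_FTC_Icc_real[OF True])
      fix s :: real assume s: "0 \<le> s" "s \<le> t"
      have "((\<lambda>s. - ((1 + s) powr (1 - p) / (p - 1))) has_real_derivative
          - ((1 - p) * (1 + s) powr (1 - p - 1) / (p - 1))) (at s)"
        using s p by (auto intro!: derivative_eq_intros)
      moreover have "- ((1 - p) * (1 + s) powr (1 - p - 1) / (p - 1)) = (1 + s) powr (- p)"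
        using p by (simp add: field_simps)
      ultimately show "DERIV (\<lambda>s. - ((1 + s) powr (1 - p) / (p - 1))) s :> (1 + s) powr (- p)" by simp
      show "isCont (\<lambda>s. (1 + s) powr (- p)) s" using s by (intro continuous_intros) auto
    qed
    then have "(LINT s : {0..t} | lborel. (1 + s) powr (- p)) = (1 - (1 + t) powr (1 - p)) / (p - 1)"
      using p by (simp add: set_lebesgue_integral_def mult.commute diff_divide_distrib)
    also have "\<dots> \<le> 1 / (p - 1)" using p by (intro divide_right_mono) auto
    finally show ?thesis .
  qed (use p in \<open>simp add: set_lebesgue_integral_def\<close>)
qed

theorem theorem2p3:
  fixes k :: "'n::finite"
    and J0 :: "real^'n \<Rightarrow> real"
    and G :: "real \<Rightarrow> (real^'n) measure"
    and a \<beta> \<alpha> :: real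
  assumes a_pos: "0 < a"
    and beta: "0 < \<beta>" "\<beta> \<le> 2"
    and J0_cont: "continuous_on UNIV J0"
    and J0_exp: "(\<lambda>\<xi>. J0 \<xi> - (1 - a * norm \<xi> powr \<beta>)) \<in> o[at 0](\<lambda>\<xi>. norm \<xi> powr \<beta>)"
    and J0_sup: "\<forall>r>0. \<exists>c<1. \<forall>\<xi>. r \<le> norm \<xi> \<longrightarrow> J0 \<xi> \<le> c"
    and G_meas: "\<forall>t>0. sets (G t) = sets borel \<and> emeasure (G t) (space (G t)) = 1"
    and G_cont: "\<forall>f :: real^'n \<Rightarrow> real. continuous_on UNIV f \<and> bounded (range f)
                   \<longrightarrow> continuous_on {0<..} (\<lambda>t. \<integral> x. f x \<partial>G t)"
    and G_evenN: "\<forall>t>0. \<forall>f :: real^'n \<Rightarrow> real. continuous_on UNIV f \<and> bounded (range f)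
                   \<and> (\<forall>x. f (reflN k x) = - f x) \<longrightarrow> (\<integral> x. f x \<partial>G t) = 0"
    and G_evenT: "\<forall>t>0. \<forall>f :: real^'n \<Rightarrow> real. continuous_on UNIV f \<and> bounded (range f)
                   \<and> (\<forall>x. f (reflT k x) = - f x) \<longrightarrow> (\<integral> x. f x \<partial>G t) = 0"
    and G_fourier: "\<forall>t>0. \<forall>\<xi>. fourier_measure (G t) \<xi> = complex_of_real (exp (t * (J0 \<xi> - 1)))"
    and comp_lin: "\<forall>v0 w0. half_data k v0 \<and> half_data k w0
                     \<and> (AE x in lborel. x \<in> halfspace k \<longrightarrow> v0 x \<le> w0 x) \<longrightarrow>
                     (\<forall>t>0. AE x in lborel. x \<in> halfspace k \<longrightarrow>
                        conv (G t) (oddext k v0) x \<le> conv (G t) (oddext k w0) x)"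
    and comp_semi: "\<forall>v0 w0 T v w. half_data k v0 \<and> half_data k w0
                     \<and> (AE x in lborel. x \<in> halfspace k \<longrightarrow> v0 x \<le> w0 x)
                     \<and> mild_sol G \<alpha> (oddext k v0) T v \<and> mild_sol G \<alpha> (oddext k w0) T w \<longrightarrow>
                     (\<forall>t. 0 \<le> t \<and> ereal t < T \<longrightarrow>
                        (AE x in lborel. x \<in> halfspace k \<longrightarrow> v t x \<le> w t x))"
    and alpha: "\<beta> / (real CARD('n) + 1) < \<alpha>"
  shows "\<exists>\<epsilon>>0. \<forall>u0. init_data k u0 \<and>
           ennreal (m1 k u0) + (\<integral>\<^sup>+ \<xi>. ennreal (norm (fourier (oddext k u0) \<xi>)) \<partial>lborel)
             < ennreal \<epsilon> \<longrightarrow>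
           (\<exists>C>0. (\<exists>u. mild_sol G \<alpha> (oddext k u0) \<infinity> u) \<and>
              (\<forall>T u. mild_sol G \<alpha> (oddext k u0) T u \<longrightarrow>
                 (\<forall>t. 0 \<le> t \<and> ereal t < T \<longrightarrow>
                    (AE x in lborel. x \<in> halfspace k \<longrightarrow>
                       \<bar>u t x\<bar> \<le> C * (1 + t) powr (- (real CARD('n) + 1) / \<beta>)))))"
proof -
  interpret half_space_semigroup k G J0
  proof unfold_locales
    show "sets (G t) = sets borel \<and> emeasure (G t) (space (G t)) = 1" if "0 < t" for t
      using G_meas that by blast
    show "continuous_on {0<..} (\<lambda>t. \<integral>x. f x \<partial>G t)" if "continuous_on UNIV f" "bounded (range f)" for f :: "real^'n \<Rightarrow> real"
      using G_cont that by blast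
    show "(\<integral>x. f x \<partial>G t) = 0" if "0 < t" "continuous_on UNIV f" "bounded (range f)" "\<And>x. f (reflN k x) = - f x"
      for t and f :: "real^'n \<Rightarrow> real"
      using G_evenN that by blast
    show "AE x in lborel. x \<in> halfspace k \<longrightarrow> conv (G t) (oddext k v0) x \<le> conv (G t) (oddext k w0) x"
      if "half_data k v0" "half_data k w0" "AE x in lborel. x \<in> halfspace k \<longrightarrow> v0 x \<le> w0 x" "0 < t" for v0 w0 t
      using comp_lin that by blast
    show "fourier_measure (G t) \<xi> = complex_of_real (exp (t * (J0 \<xi> - 1)))" if "0 < t" for t \<xi>
      using G_fourier that by blast
  qed (rule J0_cont)
  obtain C0 where C0: "0 < C0"
    and decay: "\<And>(F :: real^'n \<Rightarrow> complex) m L t. F \<in> borel_measurable borel \<Longrightarrow> 0 \<le> m \<Longrightarrow> (\<And>\<xi>. norm (F \<xi>) \<le> 2 * m * norm \<xi>) \<Longrightarrow>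
       0 \<le> L \<Longrightarrow> (\<integral>\<^sup>+\<xi>. ennreal (norm (F \<xi>)) \<partial>lborel) \<le> ennreal L \<Longrightarrow> 0 \<le> t \<Longrightarrow>
       (\<integral>\<^sup>+\<xi>. ennreal (norm (F \<xi>) * exp (t * (J0 \<xi> - 1))) \<partial>lborel)
         \<le> ennreal (C0 * (m + L) * (1 + t) powr (- (real CARD('n) + 1) / \<beta>))"
    by (rule symbol_decay[OF a_pos beta(1) J0_exp J0_sup J0_le_1]) blast
  let ?q = "- (real CARD('n) + 1) / \<beta>"
  have \<alpha>: "0 < \<alpha>" using alpha beta by (smt (verit) divide_pos_pos of_nat_0_le_iff)
  \<comment> \<open>The decay exponent of \<open>b s powr \<alpha>\<close>; it exceeds 1, so that
    the time integral converges, exactly under the condition on \<open>\<alpha>\<close>.\<close>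
  define p where "p = - (?q * \<alpha>)"
  have p: "1 < p" using alpha beta by (simp add: p_def field_simps)
  \<comment> \<open>The value for which \<open>2 powr (1 + \<alpha>) * (C0 * \<epsilon>) powr
    \<alpha> / (p - 1)\<close> equals 1.\<close>
  define \<epsilon> where "\<epsilon> = ((p - 1) / 2 powr (1 + \<alpha>)) powr (1 / \<alpha>) / C0"
  have \<epsilon>: "0 < \<epsilon>" using p C0 by (simp add: \<epsilon>_def)
  have C\<epsilon>: "(C0 * \<epsilon>) powr \<alpha> = (p - 1) / 2 powr (1 + \<alpha>)"
    using p C0 \<alpha> by (simp add: \<epsilon>_def powr_powr)
  \<comment> \<open>The envelope contains the threshold instead of the size of the datum, so it is
    common to all small data.\<close>
  define b where "b t = C0 * \<epsilon> * (1 + max 0 t) powr ?q" for t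
  have bp: "b s powr \<alpha> = (C0 * \<epsilon>) powr \<alpha> * (1 + s) powr (- p)" if "s \<in> {0..t}" for s t
    using that C0 \<epsilon> by (simp add: b_def powr_mult powr_powr p_def)
  have b_integrable: "set_integrable lborel {0..t} (\<lambda>s. b s powr \<alpha>)" for t
  proof -
    have "set_integrable lborel {0..t} (\<lambda>s. (C0 * \<epsilon>) powr \<alpha> * (1 + s) powr (- p))"
      by (intro set_integrable_mult_right set_integrable_powr_decay p)
    then show ?thesis by (subst set_integrable_cong[OF refl refl bp])
  qed
  have b_small: "2 powr (1 + \<alpha>) * (LINT s : {0..t} | lborel. b s powr \<alpha>) \<le> 1" for t
  proof -
    have "(LINT s : {0..t} | lborel. b s powr \<alpha>) = (LINT s : {0..t} | lborel. (C0 * \<epsilon>) powr \<alpha> * (1 + s) powr (- p))"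
      by (intro set_lebesgue_integral_cong) (auto simp: bp)
    also have "\<dots> = (C0 * \<epsilon>) powr \<alpha> * (LINT s : {0..t} | lborel. (1 + s) powr (- p))"
      by simp
    also have "\<dots> \<le> (p - 1) / 2 powr (1 + \<alpha>) * (1 / (p - 1))"
      unfolding C\<epsilon> using p by (intro mult_left_mono set_integral_powr_decay_le) auto
    also have "\<dots> = 1 / 2 powr (1 + \<alpha>)" using p by simp
    finally show ?thesis by (simp add: field_simps)
  qed
  have b_le: "b t \<le> C0 * \<epsilon>" for t
  proof -
    have "(1 + max 0 t) powr ?q \<le> (1 + max 0 t) powr 0" using beta by (intro powr_mono) (auto simp: divide_nonpos_pos)
    moreover have "(1 + max 0 t) powr 0 = 1" by (subst powr_zero_eq_one) auto
    ultimately have "(1 + max 0 t) powr ?q \<le> 1" by linarith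
    then show ?thesis unfolding b_def using C0 \<epsilon> by (intro mult_left_le) auto
  qed
  show ?thesis
  proof (rule exI[of _ \<epsilon>], intro conjI \<epsilon> allI impI, elim conjE)
    fix u0 assume u0: "init_data k u0"
      and small: "ennreal (m1 k u0) + (\<integral>\<^sup>+ \<xi>. ennreal (norm (fourier (oddext k u0) \<xi>)) \<partial>lborel) < ennreal \<epsilon>"
    let ?w = "oddext k u0" and ?F = "fourier (oddext k u0)"
    have wm: "?w \<in> borel_measurable borel" using u0 by (intro borel_measurable_oddext) (simp add: init_data_def)
    have Fm: "?F \<in> borel_measurable borel" by (rule borel_measurable_fourier[OF wm])
    have hd: "half_data k u0" using u0 by (simp add: init_data_def half_data_def)
    have m0: "0 \<le> m1 k u0"
      unfolding m1_def set_lebesgue_integral_def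
    proof (rule integral_nonneg_AE)
      have "AE x in lborel. x \<in> halfspace k \<longrightarrow> 0 \<le> u0 x" using u0 by (simp add: init_data_def)
      then show "AE x in lborel. 0 \<le> indicator (halfspace k) x *\<^sub>R (x $ k * u0 x)"
        by eventually_elim (auto simp: indicator_def halfspace_def)
    qed
    have Ffin: "(\<integral>\<^sup>+ \<xi>. ennreal (norm (?F \<xi>)) \<partial>lborel) < \<infinity>"
    proof -
      have "(\<integral>\<^sup>+ \<xi>. ennreal (norm (?F \<xi>)) \<partial>lborel) \<le> ennreal (m1 k u0) + (\<integral>\<^sup>+ \<xi>. ennreal (norm (?F \<xi>)) \<partial>lborel)"
        by simp
      also note small
      also have "ennreal \<epsilon> < \<infinity>" by simp
      finally show ?thesis .
    qed
    then obtain L where L: "0 \<le> L" "(\<integral>\<^sup>+ \<xi>. ennreal (norm (?F \<xi>)) \<partial>lborel) = ennreal L"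
      by (auto simp: less_top_ennreal)
    have mL: "m1 k u0 + L \<le> \<epsilon>" using small m0 L \<epsilon> by (simp add: ennreal_plus[symmetric] ennreal_less_iff del: ennreal_plus)
    have F: "integrable lborel ?F"
      by (rule integrableI_bounded[OF _ Ffin]) (simp add: Fm)
    have V_le: "\<bar>lin_flow ?F t x\<bar> \<le> b t" for t x
    proof (rule abs_lin_flow_le[OF F], rule norm_flow_le[OF F])
      have "(\<integral>\<^sup>+\<xi>. ennreal (norm (?F \<xi>) * exp (max 0 t * (J0 \<xi> - 1))) \<partial>lborel)
          \<le> ennreal (C0 * (m1 k u0 + L) * (1 + max 0 t) powr ?q)"
        using u0 L by (intro decay[OF Fm m0] norm_fourier_oddext_le) (auto simp: init_data_def)
      also have "\<dots> \<le> ennreal (b t)"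
        unfolding b_def using mL C0 by (intro ennreal_leI mult_right_mono mult_left_mono) auto
      finally show "(\<integral>\<^sup>+\<xi>. ennreal (norm (?F \<xi>) * exp (max 0 t * (J0 \<xi> - 1))) \<partial>lborel) \<le> ennreal (b t)" .
      show "0 \<le> b t" unfolding b_def using C0 \<epsilon> by auto
    qed simp
    \<comment> \<open>One function solves on every interval, so it can be compared with a solution
      given on any \<open>T\<close>.\<close>
    obtain v where v: "\<And>T. 0 < T \<Longrightarrow> mild_sol G \<alpha> ?w T v" and vb: "\<And>t x. \<bar>v t x\<bar> \<le> 2 * b t"
      by (rule global_solution[OF u0 F \<alpha> V_le b_le b_integrable b_small]) blast
    have bound: "AE x in lborel. x \<in> halfspace k \<longrightarrow> \<bar>u t x\<bar> \<le> (2 * C0 * \<epsilon>) * (1 + t) powr ?q"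
      if u: "mild_sol G \<alpha> ?w T u" and t: "0 \<le> t" "ereal t < T" for T u t
    proof -
      have "0 < T" using u by (simp add: mild_sol_def)
      then have vT: "mild_sol G \<alpha> ?w T v" by (rule v)
      have "AE x in lborel. x \<in> halfspace k \<longrightarrow> u t x \<le> v t x"
        by (rule comp_semi[rule_format, of u0 u0 T u v t])
           (intro conjI hd u vT AE_I2 impI order_refl, rule conjI[OF t])
      moreover have "AE x in lborel. x \<in> halfspace k \<longrightarrow> v t x \<le> u t x"
        by (rule comp_semi[rule_format, of u0 u0 T v u t])
           (intro conjI hd u vT AE_I2 impI order_refl, rule conjI[OF t])
      ultimately show ?thesis
      proof eventually_elim
        case (elim x)
        then show ?case using vb[of t x] t by (auto simp: b_def)
      qed
    qed
    show "\<exists>C>0. (\<exists>u. mild_sol G \<alpha> ?w \<infinity> u) \<and>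
              (\<forall>T u. mild_sol G \<alpha> ?w T u \<longrightarrow>
                 (\<forall>t. 0 \<le> t \<and> ereal t < T \<longrightarrow>
                    (AE x in lborel. x \<in> halfspace k \<longrightarrow>
                       \<bar>u t x\<bar> \<le> C * (1 + t) powr ?q)))"
    \<comment> \<open>The factor 2 is that of the supersolution; the rest is the constant of the
      envelope.\<close>
    proof (intro exI[of _ "2 * C0 * \<epsilon>"] conjI allI impI)
      show "0 < 2 * C0 * \<epsilon>" using C0 \<epsilon> by simp
      show "\<exists>u. mild_sol G \<alpha> ?w \<infinity> u" by (rule exI, rule v) simp
      fix T u t assume u: "mild_sol G \<alpha> ?w T u" and t: "0 \<le> t \<and> ereal t < T"
      show "AE x in lborel. x \<in> halfspace k \<longrightarrow> \<bar>u t x\<bar> \<le> (2 * C0 * \<epsilon>) * (1 + t) powr ?q"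
        by (rule bound[OF u t[THEN conjunct1] t[THEN conjunct2]])
    qed
  qed
qed

end
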